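(* Let $k\ge1$, $m\ge0$, $n\ge2$ and let $a_1,\dots,a_m$ be integers with $a_s>1$ for all $s$. Let $X\subset\mathbb{A}^{k+m+1}$ be the trinomial hypersurface over $\mathbb{K}$ given by $$x_1\cdots x_k\,y_1^{a_1}\cdots y_m^{a_m}=z^n+1.$$ Then every nonzero homogeneous LND of $\mathbb{K}[X]$ is maximal.
   Context: $\mathbb{K}$ is an algebraically closed field of characteristic zero. A derivation of $B=\mathbb{K}[X]$ is locally nilpotent (LND) if each element of $B$ is killed by some power of it. Two LNDs are equivalent if their kernels coincide; a nonzero LND is maximal if every nonzero LND of $B$ commuting with it is equivalent to it. $B$ is graded by $K=\mathbb{Z}^{k+m+1}/\langle(1,\dots,1,a_1,\dots,a_m,0),(0,\dots,0,n)\rangle$, where the generators $x_1,\dots,x_k,y_1,\dots,y_m,z$ are homogeneous of degrees the classes of the standard basis vectors (this is the grading corresponding to the quasitorus of all diagonal rescalings of the variables leaving $x_1\cdots x_ky_1^{a_1}\cdots y_m^{a_m}$ and $z^n$ invariant). A derivation is homogeneous if it sends $K$-homogeneous elements to $K$-homogeneous elements. *)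

theory Defs
  imports "HOL-Algebra.Algebra" "HOL-Computational_Algebra.Computational_Algebra"
    "HOL-Library.Poly_Mapping"
begin

section \<open>Locally nilpotent derivations\<close>

text \<open>
  Derivations of a commutative ring \<open>R\<close> over a subfield given by its set \<open>F\<close> of elements.
  They are HOL functions of which only the restriction to \<open>carrier R\<close> matters.
\<close>

definition derivation_over :: "'b set \<Rightarrow> ('b, 'c) ring_scheme \<Rightarrow> ('b \<Rightarrow> 'b) \<Rightarrow> bool" where
  "derivation_over F R D \<longleftrightarrow>
     D \<in> carrier R \<rightarrow> carrier R \<and>
     (\<forall>b\<in>carrier R. \<forall>c\<in>carrier R. D (b \<oplus>\<^bsub>R\<^esub> c) = D b \<oplus>\<^bsub>R\<^esub> D c) \<and>
     (\<forall>s\<in>F. \<forall>b\<in>carrier R. D (s \<otimes>\<^bsub>R\<^esub> b) = s \<otimes>\<^bsub>R\<^esub> D b) \<and>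
     (\<forall>b\<in>carrier R. \<forall>c\<in>carrier R.
        D (b \<otimes>\<^bsub>R\<^esub> c) = (D b \<otimes>\<^bsub>R\<^esub> c) \<oplus>\<^bsub>R\<^esub> (b \<otimes>\<^bsub>R\<^esub> D c))"

definition LND :: "'b set \<Rightarrow> ('b, 'c) ring_scheme \<Rightarrow> ('b \<Rightarrow> 'b) \<Rightarrow> bool" where
  "LND F R D \<longleftrightarrow> derivation_over F R D \<and> (\<forall>b\<in>carrier R. \<exists>N. (D ^^ N) b = \<zero>\<^bsub>R\<^esub>)"

definition nonzero_on :: "('b, 'c) ring_scheme \<Rightarrow> ('b \<Rightarrow> 'b) \<Rightarrow> bool" where
  "nonzero_on R D \<longleftrightarrow> (\<exists>b\<in>carrier R. D b \<noteq> \<zero>\<^bsub>R\<^esub>)"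

definition commuting_on :: "('b, 'c) ring_scheme \<Rightarrow> ('b \<Rightarrow> 'b) \<Rightarrow> ('b \<Rightarrow> 'b) \<Rightarrow> bool" where
  "commuting_on R D E \<longleftrightarrow> (\<forall>b\<in>carrier R. D (E b) = E (D b))"

definition equivalent_LND :: "('b, 'c) ring_scheme \<Rightarrow> ('b \<Rightarrow> 'b) \<Rightarrow> ('b \<Rightarrow> 'b) \<Rightarrow> bool" where
  "equivalent_LND R D E \<longleftrightarrow> a_kernel R R D = a_kernel R R E"

definition maximal_LND :: "'b set \<Rightarrow> ('b, 'c) ring_scheme \<Rightarrow> ('b \<Rightarrow> 'b) \<Rightarrow> bool" where
  "maximal_LND F R D \<longleftrightarrow>
     LND F R D \<and> nonzero_on R D \<and>
     (\<forall>E. LND F R E \<and> nonzero_on R E \<and> commuting_on R D E \<longrightarrow> equivalent_LND R E D)"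

section \<open>The coordinate ring of the trinomial hypersurface\<close>

text \<open>
  The variables are \<open>Vx 1, \<dots>, Vx k, Vy 1, \<dots>, Vy m, Vz\<close>.  Monomials are exponent vectors
  \<open>var \<Rightarrow>\<^sub>0 nat\<close>, and polynomials are finitely supported functions on monomials, whose ring
  operations (with convolution as product) are those of \<^theory>\<open>HOL-Library.Poly_Mapping\<close>.
  The number of variables is imposed through the carrier.
\<close>

datatype var = Vx nat | Vy nat | Vz

type_synonym 'a mpoly = "(var \<Rightarrow>\<^sub>0 nat) \<Rightarrow>\<^sub>0 'a"

definition vars :: "nat \<Rightarrow> nat \<Rightarrow> var set" where
  "vars k m = Vx ` {1..k} \<union> Vy ` {1..m} \<union> {Vz}"

definition mpoly_ring :: "nat \<Rightarrow> nat \<Rightarrow> 'a::field mpoly ring" where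
  "mpoly_ring k m =
     \<lparr>carrier = {p. \<forall>t\<in>Poly_Mapping.keys p. Poly_Mapping.keys t \<subseteq> vars k m},
      monoid.mult = (*), monoid.one = 1, ring.zero = 0, ring.add = (+)\<rparr>"

definition const_mpoly :: "'a::field \<Rightarrow> 'a mpoly" where
  "const_mpoly c = Poly_Mapping.single 0 c"

definition var_mpoly :: "var \<Rightarrow> 'a::field mpoly" where
  "var_mpoly v = Poly_Mapping.single (Poly_Mapping.single v 1) 1"

definition trinomial :: "nat \<Rightarrow> nat \<Rightarrow> nat \<Rightarrow> (nat \<Rightarrow> nat) \<Rightarrow> 'a::field mpoly" where
  "trinomial k m n a =
     (\<Prod>i=1..k. var_mpoly (Vx i)) * (\<Prod>s=1..m. var_mpoly (Vy s) ^ a s) - (var_mpoly Vz ^ n + 1)"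

definition trinomial_ideal :: "nat \<Rightarrow> nat \<Rightarrow> nat \<Rightarrow> (nat \<Rightarrow> nat) \<Rightarrow> 'a::field mpoly set" where
  "trinomial_ideal k m n a = PIdl\<^bsub>mpoly_ring k m\<^esub> (trinomial k m n a)"

definition coord_ring :: "nat \<Rightarrow> nat \<Rightarrow> nat \<Rightarrow> (nat \<Rightarrow> nat) \<Rightarrow> 'a::field mpoly set ring" where
  "coord_ring k m n a = mpoly_ring k m Quot trinomial_ideal k m n a"

definition residue_class ::
    "nat \<Rightarrow> nat \<Rightarrow> nat \<Rightarrow> (nat \<Rightarrow> nat) \<Rightarrow> 'a::field mpoly \<Rightarrow> 'a mpoly set" where
  "residue_class k m n a p = trinomial_ideal k m n a +>\<^bsub>mpoly_ring k m\<^esub> p"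

definition ground_field :: "nat \<Rightarrow> nat \<Rightarrow> nat \<Rightarrow> (nat \<Rightarrow> nat) \<Rightarrow> 'a::field mpoly set set" where
  "ground_field k m n a = {residue_class k m n a (const_mpoly c) | c. True}"

section \<open>The grading\<close>

text \<open>
  The lattice of exponent vectors, written multiplicatively as an HOL-Algebra group, is the free
  abelian group on the variables; \<open>frag_of v\<close> is the standard basis vector belonging to \<open>v\<close>.
\<close>

definition weight_relations :: "nat \<Rightarrow> nat \<Rightarrow> nat \<Rightarrow> (nat \<Rightarrow> nat) \<Rightarrow> (var \<Rightarrow>\<^sub>0 int) set" where
  "weight_relations k m n a =
     generate (free_Abelian_group (vars k m))
       {(\<Sum>i=1..k. frag_of (Vx i)) + (\<Sum>s=1..m. frag_cmul (int (a s)) (frag_of (Vy s))),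
        frag_cmul (int n) (frag_of Vz)}"

definition weight_group :: "nat \<Rightarrow> nat \<Rightarrow> nat \<Rightarrow> (nat \<Rightarrow> nat) \<Rightarrow> (var \<Rightarrow>\<^sub>0 int) set monoid" where
  "weight_group k m n a = free_Abelian_group (vars k m) Mod weight_relations k m n a"

text \<open>The degree of a monomial; for the variable \<open>v\<close> it is the class of \<open>frag_of v\<close>.\<close>

definition weight ::
    "nat \<Rightarrow> nat \<Rightarrow> nat \<Rightarrow> (nat \<Rightarrow> nat) \<Rightarrow> (var \<Rightarrow>\<^sub>0 nat) \<Rightarrow> (var \<Rightarrow>\<^sub>0 int) set" where
  "weight k m n a t =
     weight_relations k m n a #>\<^bsub>free_Abelian_group (vars k m)\<^esub> Poly_Mapping.map int t"

definition component ::
    "nat \<Rightarrow> nat \<Rightarrow> nat \<Rightarrow> (nat \<Rightarrow> nat) \<Rightarrow> (var \<Rightarrow>\<^sub>0 int) set \<Rightarrow> 'a::field mpoly set set" where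
  "component k m n a w =
     residue_class k m n a `
       {p \<in> carrier (mpoly_ring k m). \<forall>t\<in>Poly_Mapping.keys p. weight k m n a t = w}"

definition homogeneous ::
    "nat \<Rightarrow> nat \<Rightarrow> nat \<Rightarrow> (nat \<Rightarrow> nat) \<Rightarrow> 'a::field mpoly set \<Rightarrow> bool" where
  "homogeneous k m n a b \<longleftrightarrow>
     (\<exists>w\<in>carrier (weight_group k m n a). b \<in> component k m n a w)"

definition homogeneous_derivation ::
    "nat \<Rightarrow> nat \<Rightarrow> nat \<Rightarrow> (nat \<Rightarrow> nat) \<Rightarrow> ('a::field mpoly set \<Rightarrow> 'a mpoly set) \<Rightarrow> bool" where
  "homogeneous_derivation k m n a D \<longleftrightarrow>
     derivation_over (ground_field k m n a) (coord_ring k m n a) D \<and>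
     (\<forall>b. homogeneous k m n a b \<longrightarrow> homogeneous k m n a (D b))"

end

theory Submission
  imports Defs
begin

text \<open>
  Write \<open>M\<close> for the monomial \<open>x\<^sub>1 \<dots> x\<^sub>k y\<^sub>1\<^bsup>a\<^sub>1\<^esup> \<dots> y\<^sub>m\<^bsup>a\<^sub>m\<^esup>\<close>, so that the coordinate ring \<open>B\<close> has the single
  relation \<open>M = z\<^sup>n + 1\<close>.  The proof determines the kernel of a homogeneous locally nilpotent
  derivation \<open>D\<close>: it is the polynomial ring in all variables except \<open>z\<close> and one of the \<open>x\<^sub>j\<close>.

  The tool is the degree \<open>ndeg\<close> of a locally nilpotent derivation \<open>F\<close>, the largest order to which \<open>F\<close>
  can be applied to an element without killing it.  It is additive on products
  (\<open>ndeg_mult\<close>), so the kernel contains every factor of its nonzero elements (\<open>factor_killed\<close>), and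
  \<open>F b = c b\<close> implies \<open>F b = 0\<close> (\<open>killed_if_dvd_image\<close>).  The relation gives \<open>ndeg M = n ndeg z\<close> with
  \<open>ndeg z > 0\<close>.

  A homogeneous element is a monomial times a factor \<open>c + M G\<close> with a scalar \<open>c\<close>
  (\<open>homogeneous_shape\<close>).  If its degree is below that of \<open>M\<close>, then \<open>G = 0\<close>.  As \<open>D\<close> lowers degrees, it
  therefore sends every variable to a scalar multiple of a monomial.  The monomials of \<open>z\<close>-exponent
  below \<open>n\<close> are linearly independent in \<open>B\<close>, so coefficients can be compared in
  \<open>D M = n z\<^bsup>n-1\<^esup> D z\<close>.  The right-hand side must occur on the left, in the term \<open>P D w\<close> of some
  variable \<open>w\<close>, where \<open>P = M / w\<close>.  As \<open>z\<close> occurs neither in \<open>P\<close> nor in \<open>D z\<close>, the factor \<open>z\<^bsup>n-1\<^esup>\<close> belongs to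
  \<open>D w\<close>; so \<open>P\<close> divides \<open>D z\<close>, and \<open>ndeg P < ndeg z\<close>.  If \<open>w\<^sup>2\<close> divided \<open>M\<close>, then \<open>w\<close> would divide \<open>P\<close>, so that
  \<open>ndeg M \<le> 2 ndeg P < 2 ndeg z\<close>, which is absurd; hence \<open>w\<close> is some \<open>x\<^sub>j\<close>.  The terms without \<open>z\<close> add up to \<open>x\<^sub>j D P = 0\<close>.  So \<open>D\<close> kills all factors of
  \<open>P\<close>, that is, all variables except \<open>z\<close> and \<open>x\<^sub>j\<close>, and \<open>D z\<close> is a multiple of \<open>P\<close> in the kernel
  (\<open>shape_of_homogeneous_lnd\<close>).

  Let \<open>A\<close> be the polynomial ring in the variables other than \<open>z\<close> and \<open>x\<^sub>j\<close>.  If a nonzero locally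
  nilpotent derivation \<open>F\<close> kills \<open>A\<close>, then \<open>x\<^sub>j\<close> has degree \<open>n ndeg z\<close>, so the elements \<open>z\<^sup>i x\<^sub>j\<^sup>l\<close> with
  \<open>i < n\<close>, which generate \<open>B\<close> over \<open>A\<close>, have distinct degrees.  It follows that the kernel of
  \<open>F\<close> is \<open>A\<close> (\<open>kernel_eq\<close>), and that elements of degree at most \<open>ndeg z\<close> lie in \<open>A + A z\<close>
  (\<open>linear_of_low_degree\<close>).  Now let \<open>E\<close> commute with \<open>D\<close>.  From \<open>D (D (E z)) = E (D (D z)) = 0\<close> one gets
  \<open>E z = \<beta> + \<gamma> z\<close> with \<open>\<beta>, \<gamma> \<in> A\<close>, hence \<open>E (D z) = D (E z) = \<gamma> D z\<close> and so \<open>E (D z) = 0\<close>.  As \<open>P\<close> divides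
  \<open>D z\<close>, also \<open>E\<close> kills \<open>A\<close>, and both kernels are \<open>A\<close> (\<open>commuting_kernel_eq\<close>).

  These arguments take place in a subring of an integral domain.  The Laurent polynomials provide
  one: \<open>x\<^sub>1\<close> is sent to \<open>(z\<^sup>n + 1) x\<^sub>1 / M\<close>, a Laurent polynomial in the other variables, and these
  variables to themselves.  Leading exponents show that the images of the monomials of \<open>z\<close>-exponent
  below \<open>n\<close> are linearly independent (\<open>trinomial_model_laurent\<close>), so this map embeds \<open>B\<close>.
\<close>

section \<open>Locally nilpotent derivations of a domain of characteristic zero\<close>

locale lnd =
  fixes B :: "'b::{idom, ring_char_0} set" and F :: "'b \<Rightarrow> 'b"
  assumes one_mem: "1 \<in> B"
    and add_mem: "b \<in> B \<Longrightarrow> c \<in> B \<Longrightarrow> b + c \<in> B"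
    and uminus_mem: "b \<in> B \<Longrightarrow> - b \<in> B"
    and mult_mem: "b \<in> B \<Longrightarrow> c \<in> B \<Longrightarrow> b * c \<in> B"
    and F_mem: "b \<in> B \<Longrightarrow> F b \<in> B"
    and F_add: "b \<in> B \<Longrightarrow> c \<in> B \<Longrightarrow> F (b + c) = F b + F c"
    and F_mult: "b \<in> B \<Longrightarrow> c \<in> B \<Longrightarrow> F (b * c) = F b * c + b * F c"
    and F_nilpotent: "b \<in> B \<Longrightarrow> \<exists>N. (F ^^ N) b = 0"
begin

lemma zero_mem: "0 \<in> B"
  using add_mem[OF one_mem uminus_mem[OF one_mem]] by simp

lemma F_zero: "F 0 = 0"
  using F_add[OF zero_mem zero_mem] by simp

lemma F_one: "F 1 = 0"
  using F_mult[OF one_mem one_mem] by simp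

lemma power_mem: "b \<in> B \<Longrightarrow> b ^ N \<in> B"
  by (induction N) (auto simp: one_mem mult_mem)

lemma prod_mem: "(\<And>i. i \<in> S \<Longrightarrow> f i \<in> B) \<Longrightarrow> prod f S \<in> B"
  by (induction S rule: infinite_finite_induct) (auto simp: one_mem mult_mem)

lemma sum_mem: "(\<And>i. i \<in> S \<Longrightarrow> f i \<in> B) \<Longrightarrow> sum f S \<in> B"
  by (induction S rule: infinite_finite_induct) (auto simp: zero_mem add_mem)

lemma of_nat_mem: "of_nat N \<in> B"
  by (induction N) (auto simp: zero_mem one_mem add_mem)

lemma F_sum: "(\<And>i. i \<in> S \<Longrightarrow> f i \<in> B) \<Longrightarrow> F (sum f S) = (\<Sum>i\<in>S. F (f i))"
  by (induction S rule: infinite_finite_induct) (auto simp: F_zero F_add sum_mem)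

lemma F_of_nat: "F (of_nat N) = 0"
  by (induction N) (auto simp: F_zero F_one F_add of_nat_mem one_mem)

lemma F_power: "b \<in> B \<Longrightarrow> F (b ^ N) = of_nat N * b ^ (N - 1) * F b"
proof (induction N)
  case (Suc N)
  have "F (b ^ Suc N) = F b * b ^ N + b * F (b ^ N)"
    using Suc.prems by (simp add: F_mult power_mem)
  also have "\<dots> = of_nat (Suc N) * b ^ (Suc N - 1) * F b"
    using Suc by (cases N) (auto simp: algebra_simps)
  finally show ?case .
qed (simp add: F_one)

lemma F_prod_powers:
  assumes "finite S" "\<And>v. v \<in> S \<Longrightarrow> f v \<in> B"
  shows "F (\<Prod>v\<in>S. f v ^ e v) =
    (\<Sum>v\<in>S. of_nat (e v) * (f v ^ (e v - 1) * (\<Prod>w\<in>S - {v}. f w ^ e w)) * F (f v))"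
  using assms
proof (induction S rule: finite_induct)
  case empty
  then show ?case by (simp add: F_one)
next
  case (insert u S)
  have fB: "f v \<in> B" if "v \<in> insert u S" for v using insert.prems that by auto
  have eq: "f u ^ e u * (\<Prod>w\<in>S - {v}. f w ^ e w) = (\<Prod>w\<in>insert u S - {v}. f w ^ e w)" if "v \<in> S" for v
  proof -
    have "insert u S - {v} = insert u (S - {v})" using that insert.hyps by auto
    then show ?thesis using insert.hyps by simp
  qed
  have "F (\<Prod>v\<in>insert u S. f v ^ e v) = F (f u ^ e u) * (\<Prod>v\<in>S. f v ^ e v) + f u ^ e u * F (\<Prod>v\<in>S. f v ^ e v)"
    using insert.hyps fB by (simp add: F_mult power_mem prod_mem)
  also have "F (\<Prod>v\<in>S. f v ^ e v) =
      (\<Sum>v\<in>S. of_nat (e v) * (f v ^ (e v - 1) * (\<Prod>w\<in>S - {v}. f w ^ e w)) * F (f v))"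
    using insert.IH fB by simp
  also have "f u ^ e u * \<dots> =
      (\<Sum>v\<in>S. of_nat (e v) * (f v ^ (e v - 1) * (\<Prod>w\<in>insert u S - {v}. f w ^ e w)) * F (f v))"
    unfolding sum_distrib_left by (intro sum.cong refl) (simp add: eq[symmetric] algebra_simps)
  finally show ?case
    using insert.hyps fB by (simp add: F_power algebra_simps)
qed

lemma iter_mem: "b \<in> B \<Longrightarrow> (F ^^ N) b \<in> B"
  by (induction N) (auto simp: F_mem)

lemma iter_zero: "(F ^^ N) 0 = 0"
  by (induction N) (auto simp: F_zero)

lemma iter_add: "b \<in> B \<Longrightarrow> c \<in> B \<Longrightarrow> (F ^^ N) (b + c) = (F ^^ N) b + (F ^^ N) c"
  by (induction N) (auto simp: F_add iter_mem)

lemma iter_eq_0_mono: "(F ^^ N) b = 0 \<Longrightarrow> N \<le> M \<Longrightarrow> (F ^^ M) b = 0"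
  by (metis comp_apply funpow_add iter_zero le_add_diff_inverse2)

lemma iter_mult:
  assumes "b \<in> B" "c \<in> B"
  shows "(F ^^ N) (b * c) = (\<Sum>i\<le>N. of_nat (N choose i) * ((F ^^ i) b * (F ^^ (N - i)) c))"
proof (induction N)
  case (Suc N)
  let ?t = "\<lambda>i j. (F ^^ i) b * (F ^^ j) c"
  have tB: "?t i j \<in> B" for i j using assms by (simp add: mult_mem iter_mem)
  have Ft: "F (?t i j) = ?t (Suc i) j + ?t i (Suc j)" for i j
    using assms by (simp add: F_mult iter_mem)
  have "(F ^^ Suc N) (b * c) = (\<Sum>i\<le>N. F (of_nat (N choose i) * ?t i (N - i)))"
    using Suc tB by (simp add: F_sum mult_mem of_nat_mem)
  also have "\<dots> = (\<Sum>i\<le>N. of_nat (N choose i) * (?t (Suc i) (N - i) + ?t i (Suc (N - i))))"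
    using tB by (intro sum.cong refl) (simp add: F_mult of_nat_mem F_of_nat Ft)
  also have "\<dots> = (\<Sum>i\<le>N. of_nat (N choose i) * ?t (Suc i) (N - i)) +
      (\<Sum>i\<le>N. of_nat (N choose i) * ?t i (Suc (N - i)))"
    by (simp add: algebra_simps sum.distrib)
  also have "(\<Sum>i\<le>N. of_nat (N choose i) * ?t i (Suc (N - i))) =
      (\<Sum>i\<le>Suc N. of_nat (N choose i) * ?t i (Suc N - i))"
    by (auto intro!: sum.cong simp: Suc_diff_le)
  also have "\<dots> = ?t 0 (Suc N) + (\<Sum>i\<le>N. of_nat (N choose Suc i) * ?t (Suc i) (N - i))"
    by (subst sum.atMost_Suc_shift) simp
  finally have "(F ^^ Suc N) (b * c) = ?t 0 (Suc N) +
      (\<Sum>i\<le>N. of_nat (N choose i) * ?t (Suc i) (N - i) + of_nat (N choose Suc i) * ?t (Suc i) (N - i))"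
    by (simp only: sum.distrib ac_simps)
  also have "\<dots> = (\<Sum>i\<le>Suc N. of_nat (Suc N choose i) * ?t i (Suc N - i))"
    by (subst sum.atMost_Suc_shift) (simp add: algebra_simps)
  finally show ?case .
qed simp

text \<open>
  For \<open>b \<noteq> 0\<close> this is the degree in \<open>t\<close> of \<open>exp (t F) b\<close>.  The value at \<open>0\<close> is \<open>0\<close>.
\<close>

definition ndeg :: "'b \<Rightarrow> nat" where
  "ndeg b = (LEAST N. (F ^^ Suc N) b = 0)"

lemma iter_eq_0_iff:
  assumes "b \<in> B" "b \<noteq> 0"
  shows "(F ^^ N) b = 0 \<longleftrightarrow> ndeg b < N"
proof -
  obtain N0 where N0: "(F ^^ N0) b = 0" using F_nilpotent assms by blast
  then have "(F ^^ Suc N0) b = 0" by (simp add: F_zero)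
  then have "(F ^^ Suc (ndeg b)) b = 0" unfolding ndeg_def by (rule LeastI)
  moreover have "(F ^^ ndeg b) b \<noteq> 0"
  proof (cases "ndeg b")
    case (Suc N)
    then show ?thesis using not_less_Least[of N "\<lambda>N. (F ^^ Suc N) b = 0"] unfolding ndeg_def by auto
  qed (use assms in simp)
  ultimately show ?thesis using iter_eq_0_mono
    by (metis Suc_leI not_less)
qed

lemma ndeg_eqI:
  assumes "b \<in> B" "(F ^^ N) b \<noteq> 0" "(F ^^ Suc N) b = 0"
  shows "ndeg b = N"
proof -
  have "b \<noteq> 0" using assms(2) iter_zero by auto
  then show ?thesis using iter_eq_0_iff[OF assms(1)] assms by (metis less_Suc_eq linorder_neqE_nat)
qed

lemma ndeg_eq_0_iff: "b \<in> B \<Longrightarrow> b \<noteq> 0 \<Longrightarrow> ndeg b = 0 \<longleftrightarrow> F b = 0"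
  using iter_eq_0_iff[of b 1] by simp

lemma ndeg_eq_0: "b \<in> B \<Longrightarrow> F b = 0 \<Longrightarrow> ndeg b = 0"
  unfolding ndeg_def by (intro Least_eq_0) simp

lemma ndeg_F:
  assumes "b \<in> B" "F b \<noteq> 0" shows "ndeg b = Suc (ndeg (F b))"
proof (rule ndeg_eqI[OF assms(1)])
  note iff = iter_eq_0_iff[OF F_mem[OF assms(1)] assms(2)]
  show "(F ^^ Suc (ndeg (F b))) b \<noteq> 0"
    unfolding funpow_Suc_right comp_apply iff by blast
  show "(F ^^ Suc (Suc (ndeg (F b)))) b = 0"
    unfolding funpow_Suc_right[of "Suc (ndeg (F b))"] comp_apply iff by blast
qed

text \<open>
  In the Leibniz formula for \<open>F\<^bsup>p+q\<^esup> (b c)\<close>, with \<open>p\<close> and \<open>q\<close> the degrees of \<open>b\<close> and \<open>c\<close>, only the term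
  \<open>F\<^sup>p b F\<^sup>q c\<close> survives.  Its binomial coefficient is nonzero by the assumption on the characteristic.
\<close>

lemma ndeg_mult:
  assumes "b \<in> B" "c \<in> B" "b \<noteq> 0" "c \<noteq> 0"
  shows "ndeg (b * c) = ndeg b + ndeg c"
proof (rule ndeg_eqI)
  let ?p = "ndeg b" and ?q = "ndeg c"
  show "b * c \<in> B" using assms by (simp add: mult_mem)
  have b0: "(F ^^ i) b = 0 \<longleftrightarrow> ?p < i" for i using iter_eq_0_iff assms by blast
  have c0: "(F ^^ i) c = 0 \<longleftrightarrow> ?q < i" for i using iter_eq_0_iff assms by blast
  have "(F ^^ (?p + ?q)) (b * c) =
      (\<Sum>i\<le>?p + ?q. of_nat ((?p + ?q) choose i) * ((F ^^ i) b * (F ^^ (?p + ?q - i)) c))"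
    using iter_mult assms by blast
  also have "\<dots> = (\<Sum>i\<in>{?p}. of_nat ((?p + ?q) choose i) * ((F ^^ i) b * (F ^^ (?p + ?q - i)) c))"
    by (intro sum.mono_neutral_right) (auto simp: b0 c0)
  finally show "(F ^^ (?p + ?q)) (b * c) \<noteq> 0" by (simp add: b0 c0)
  have *: "of_nat (Suc (?p + ?q) choose i) * ((F ^^ i) b * (F ^^ (Suc (?p + ?q) - i)) c) = 0" for i
  proof (cases "?p < i")
    case True then show ?thesis using b0[of i] by simp
  next
    case False
    then have "?q < Suc (?p + ?q) - i" by simp
    then show ?thesis using c0 by simp
  qed
  show "(F ^^ Suc (?p + ?q)) (b * c) = 0"
    unfolding iter_mult[OF assms(1,2)] by (intro sum.neutral ballI *)
qed

lemma ndeg_one: "ndeg 1 = 0"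
  by (simp add: ndeg_eq_0 one_mem F_one)

lemma ndeg_power: "b \<in> B \<Longrightarrow> b \<noteq> 0 \<Longrightarrow> ndeg (b ^ N) = N * ndeg b"
  by (induction N) (auto simp: ndeg_one ndeg_mult power_mem)

lemma ndeg_prod:
  "(\<And>i. i \<in> S \<Longrightarrow> f i \<in> B) \<Longrightarrow> (\<And>i. i \<in> S \<Longrightarrow> f i \<noteq> 0) \<Longrightarrow> ndeg (prod f S) = (\<Sum>i\<in>S. ndeg (f i))"
  by (induction S rule: infinite_finite_induct) (auto simp: ndeg_one ndeg_mult prod_mem)

lemma ndeg_add_killed:
  assumes "b \<in> B" "c \<in> B" "F b = 0" "0 < ndeg c"
  shows "ndeg (b + c) = ndeg c" "b + c \<noteq> 0"
proof -
  have c: "c \<noteq> 0" using assms(4) ndeg_eq_0[OF zero_mem F_zero] by auto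
  have i: "(F ^^ Suc N) (b + c) = (F ^^ Suc N) c" for N
    using assms(1-3) by (simp add: F_add funpow_Suc_right del: funpow.simps)
  show "ndeg (b + c) = ndeg c" unfolding ndeg_def i ..
  then show "b + c \<noteq> 0" using assms(4) ndeg_eq_0[OF zero_mem F_zero] by auto
qed

text \<open>
  Two degrees with sum \<open>0\<close> are both \<open>0\<close>.
\<close>

lemma factor_killed:
  assumes "b \<in> B" "c \<in> B" "b * c \<noteq> 0" "F (b * c) = 0"
  shows "F b = 0"
proof -
  have "ndeg (b * c) = 0" using assms by (simp add: ndeg_eq_0 mult_mem)
  then show ?thesis using assms ndeg_mult[of b c] ndeg_eq_0_iff[of b] by auto
qed

text \<open>
  If \<open>F b\<close> were nonzero, its degree would be below that of \<open>b\<close>, while a nonzero multiple of \<open>b\<close> has at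
  least the degree of \<open>b\<close>.
\<close>

lemma killed_if_dvd_image:
  assumes "b \<in> B" "c \<in> B" "F b = c * b"
  shows "F b = 0"
proof (rule ccontr)
  assume nz: "F b \<noteq> 0"
  then have "c \<noteq> 0" "b \<noteq> 0" using assms by auto
  then have "ndeg (F b) = ndeg c + ndeg b" using assms by (simp add: ndeg_mult)
  then show False using ndeg_F[OF assms(1) nz] by simp
qed

end

section \<open>Evaluating polynomials\<close>

abbreviation "keys \<equiv> Poly_Mapping.keys"
abbreviation "lookup \<equiv> Poly_Mapping.lookup"
abbreviation "single \<equiv> Poly_Mapping.single"

definition mon_eval :: "('v \<Rightarrow> 'b::comm_ring_1) \<Rightarrow> ('v \<Rightarrow>\<^sub>0 nat) \<Rightarrow> 'b" where
  "mon_eval \<xi> t = (\<Prod>v\<in>keys t. \<xi> v ^ lookup t v)"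

text \<open>
  The scalars are mapped by \<open>\<iota>\<close> and the variables by \<open>\<xi>\<close>.
\<close>

definition mpoly_eval ::
    "('a::zero \<Rightarrow> 'b) \<Rightarrow> ('v \<Rightarrow> 'b::comm_ring_1) \<Rightarrow> (('v \<Rightarrow>\<^sub>0 nat) \<Rightarrow>\<^sub>0 'a) \<Rightarrow> 'b" where
  "mpoly_eval \<iota> \<xi> p = (\<Sum>t\<in>keys p. \<iota> (lookup p t) * mon_eval \<xi> t)"

lemma mon_eval_superset:
  assumes "finite S" "keys t \<subseteq> S"
  shows "mon_eval \<xi> t = (\<Prod>v\<in>S. \<xi> v ^ lookup t v)"
  unfolding mon_eval_def using assms
  by (intro prod.mono_neutral_left) (auto simp: in_keys_iff)

lemma mon_eval_zero [simp]: "mon_eval \<xi> 0 = 1"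
  by (simp add: mon_eval_def)

lemma mon_eval_single [simp]: "mon_eval \<xi> (single v e) = \<xi> v ^ e"
  by (simp add: mon_eval_superset[of "{v}"])

lemma mon_eval_add: "mon_eval \<xi> (s + t) = mon_eval \<xi> s * mon_eval \<xi> t"
proof -
  let ?S = "keys s \<union> keys t"
  have "mon_eval \<xi> (s + t) = (\<Prod>v\<in>?S. \<xi> v ^ lookup (s + t) v)"
    by (rule mon_eval_superset) (auto simp: keys_add)
  also have "\<dots> = (\<Prod>v\<in>?S. \<xi> v ^ lookup s v) * (\<Prod>v\<in>?S. \<xi> v ^ lookup t v)"
    by (simp add: lookup_add power_add prod.distrib)
  also have "\<dots> = mon_eval \<xi> s * mon_eval \<xi> t"
    by (simp add: mon_eval_superset[of ?S])
  finally show ?thesis .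
qed

lemma mon_eval_sum: "mon_eval \<xi> (sum f S) = (\<Prod>i\<in>S. mon_eval \<xi> (f i))"
  by (induction S rule: infinite_finite_induct) (auto simp: mon_eval_add)

lemma sum_singles: "(\<Sum>t\<in>keys p. single t (lookup p t)) = p"
  by (rule poly_mapping_eqI) (auto simp: lookup_sum lookup_single when_def in_keys_iff sum.delta)

locale scalar_hom =
  fixes \<iota> :: "'a::field \<Rightarrow> 'b::comm_ring_1"
  assumes \<iota>_add: "\<iota> (c + d) = \<iota> c + \<iota> d"
    and \<iota>_mult: "\<iota> (c * d) = \<iota> c * \<iota> d"
    and \<iota>_one: "\<iota> 1 = 1"
begin

lemma \<iota>_zero: "\<iota> 0 = 0"
  using \<iota>_add[of 0 0] by simp

lemma \<iota>_uminus: "\<iota> (- c) = - \<iota> c"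
  using \<iota>_add[of c "- c"] by (simp add: \<iota>_zero add_eq_0_iff)

lemma \<iota>_of_nat: "\<iota> (of_nat N) = of_nat N"
  by (induction N) (auto simp: \<iota>_zero \<iota>_one \<iota>_add)

lemma mpoly_eval_superset:
  assumes "finite S" "keys p \<subseteq> S"
  shows "mpoly_eval \<iota> \<xi> p = (\<Sum>t\<in>S. \<iota> (lookup p t) * mon_eval \<xi> t)"
  unfolding mpoly_eval_def using assms
  by (intro sum.mono_neutral_left) (auto simp: in_keys_iff \<iota>_zero)

lemma mpoly_eval_single [simp]: "mpoly_eval \<iota> \<xi> (single t c) = \<iota> c * mon_eval \<xi> t"
  by (simp add: mpoly_eval_superset[of "{t}"])

lemma mpoly_eval_zero [simp]: "mpoly_eval \<iota> \<xi> 0 = 0"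
  by (simp add: mpoly_eval_def)

lemma mpoly_eval_one [simp]: "mpoly_eval \<iota> \<xi> 1 = 1"
  using mpoly_eval_single[of \<xi> 0 1] by (simp add: \<iota>_one del: mpoly_eval_single)

lemma mpoly_eval_add: "mpoly_eval \<iota> \<xi> (p + q) = mpoly_eval \<iota> \<xi> p + mpoly_eval \<iota> \<xi> q"
proof -
  let ?S = "keys p \<union> keys q"
  have "mpoly_eval \<iota> \<xi> (p + q) = (\<Sum>t\<in>?S. \<iota> (lookup (p + q) t) * mon_eval \<xi> t)"
    by (rule mpoly_eval_superset) (auto simp: keys_add)
  also have "\<dots> = mpoly_eval \<iota> \<xi> p + mpoly_eval \<iota> \<xi> q"
    by (simp add: mpoly_eval_superset[of ?S] lookup_add \<iota>_add distrib_right sum.distrib)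
  finally show ?thesis .
qed

lemma mpoly_eval_uminus: "mpoly_eval \<iota> \<xi> (- p) = - mpoly_eval \<iota> \<xi> p"
  using mpoly_eval_add[of \<xi> p "- p"] by (simp add: add_eq_0_iff)

lemma mpoly_eval_diff: "mpoly_eval \<iota> \<xi> (p - q) = mpoly_eval \<iota> \<xi> p - mpoly_eval \<iota> \<xi> q"
  using mpoly_eval_add[of \<xi> p "- q"] by (simp add: mpoly_eval_uminus)

lemma mpoly_eval_sum: "mpoly_eval \<iota> \<xi> (sum f S) = (\<Sum>i\<in>S. mpoly_eval \<iota> \<xi> (f i))"
  by (induction S rule: infinite_finite_induct) (auto simp: mpoly_eval_add)

lemma mpoly_eval_mult: "mpoly_eval \<iota> \<xi> (p * q) = mpoly_eval \<iota> \<xi> p * mpoly_eval \<iota> \<xi> q"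
proof -
  have "p * q = (\<Sum>s\<in>keys p. single s (lookup p s)) * (\<Sum>t\<in>keys q. single t (lookup q t))"
    by (simp only: sum_singles)
  also have "\<dots> = (\<Sum>s\<in>keys p. \<Sum>t\<in>keys q. single (s + t) (lookup p s * lookup q t))"
    by (simp add: sum_product mult_single)
  finally have "mpoly_eval \<iota> \<xi> (p * q) = (\<Sum>s\<in>keys p. \<Sum>t\<in>keys q.
      (\<iota> (lookup p s) * mon_eval \<xi> s) * (\<iota> (lookup q t) * mon_eval \<xi> t))"
    by (simp add: mpoly_eval_sum \<iota>_mult mon_eval_add ac_simps)
  then show ?thesis by (simp add: mpoly_eval_def sum_product)
qed

lemma mpoly_eval_const: "mpoly_eval \<iota> \<xi> (const_mpoly c) = \<iota> c"
  by (simp add: const_mpoly_def)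

lemma mpoly_eval_var: "mpoly_eval \<iota> \<xi> (var_mpoly v) = \<xi> v"
  by (simp add: var_mpoly_def \<iota>_one)

end

section \<open>The polynomial ring and reduction modulo the trinomial\<close>

abbreviation mpolys :: "nat \<Rightarrow> nat \<Rightarrow> 'a::field mpoly set" where
  "mpolys k m \<equiv> carrier (mpoly_ring k m)"

lemma mpolys_iff: "p \<in> mpolys k m \<longleftrightarrow> (\<forall>t\<in>keys p. keys t \<subseteq> vars k m)"
  by (simp add: mpoly_ring_def)

lemma mpoly_ring_ops:
  "x \<otimes>\<^bsub>mpoly_ring k m\<^esub> y = x * y" "x \<oplus>\<^bsub>mpoly_ring k m\<^esub> y = x + y"
  "\<one>\<^bsub>mpoly_ring k m\<^esub> = 1" "\<zero>\<^bsub>mpoly_ring k m\<^esub> = 0"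
  by (simp_all add: mpoly_ring_def)

lemma mpolys_single: "keys t \<subseteq> vars k m \<Longrightarrow> single t c \<in> mpolys k m"
  by (simp add: mpolys_iff)

lemma mpolys_add: "p \<in> mpolys k m \<Longrightarrow> q \<in> mpolys k m \<Longrightarrow> p + q \<in> mpolys k m"
  unfolding mpolys_iff using keys_add[of p q] by blast

lemma mpolys_uminus: "p \<in> mpolys k m \<Longrightarrow> - p \<in> mpolys k m"
  by (simp add: mpolys_iff in_keys_iff)

lemma mpolys_zero: "0 \<in> mpolys k m" and mpolys_one: "1 \<in> mpolys k m"
  by (simp_all add: mpolys_iff)

lemma mpolys_diff: "p \<in> mpolys k m \<Longrightarrow> q \<in> mpolys k m \<Longrightarrow> p - q \<in> mpolys k m"
  using mpolys_add[of p k m "- q"] mpolys_uminus[of q] by simp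

lemma mpolys_sum: "(\<And>i. i \<in> S \<Longrightarrow> f i \<in> mpolys k m) \<Longrightarrow> sum f S \<in> mpolys k m"
  by (induction S rule: infinite_finite_induct) (auto simp: mpolys_zero mpolys_add)

lemma mpolys_mult:
  assumes "p \<in> mpolys k m" "q \<in> mpolys k m"
  shows "p * q \<in> mpolys k m"
proof -
  have "keys (s + t) \<subseteq> vars k m" if "s \<in> keys p" "t \<in> keys q" for s t
    using assms that keys_add[of s t] unfolding mpolys_iff by blast
  then show ?thesis using keys_mult[of p q] unfolding mpolys_iff by blast
qed

lemma finite_vars: "finite (vars k m)"
  by (simp add: vars_def)

lemma cring_mpoly_ring: "cring (mpoly_ring k m :: 'a::field mpoly ring)"
proof (intro cringI abelian_groupI comm_monoidI, unfold mpoly_ring_ops)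
  fix x :: "'a mpoly" assume x: "x \<in> mpolys k m"
  then show "\<exists>y\<in>mpolys k m. y + x = 0"
    by (intro bexI[of _ "- x"]) (auto simp: mpolys_uminus)
qed (auto simp: mpolys_add mpolys_mult mpolys_zero mpolys_one algebra_simps)

text \<open>
  The exponent vector of the monomial \<open>M\<close>.
\<close>

definition tri_exp :: "nat \<Rightarrow> nat \<Rightarrow> (nat \<Rightarrow> nat) \<Rightarrow> var \<Rightarrow>\<^sub>0 nat" where
  "tri_exp k m a = (\<Sum>i=1..k. single (Vx i) 1) + (\<Sum>s=1..m. single (Vy s) (a s))"

lemma lookup_tri_exp:
  "lookup (tri_exp k m a) (Vx i) = (if i \<in> {1..k} then 1 else 0)"
  "lookup (tri_exp k m a) (Vy s) = (if s \<in> {1..m} then a s else 0)"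
  "lookup (tri_exp k m a) Vz = 0"
  by (auto simp: tri_exp_def lookup_add lookup_sum lookup_single when_def sum.delta)

text \<open>
  The exponents \<open>a s\<close> are positive, so \<open>M\<close> involves every variable except \<open>z\<close>.
\<close>

lemma keys_tri_exp:
  assumes "\<And>s. s \<in> {1..m} \<Longrightarrow> a s > 1"
  shows "keys (tri_exp k m a) = vars k m - {Vz}"
proof (intro Set.set_eqI)
  fix v
  show "v \<in> keys (tri_exp k m a) \<longleftrightarrow> v \<in> vars k m - {Vz}"
    using assms[of "case v of Vy s \<Rightarrow> s | _ \<Rightarrow> 0"]
    by (cases v) (auto simp: in_keys_iff lookup_tri_exp vars_def)
qed

lemma keys_tri_exp_subset: "keys (tri_exp k m a) \<subseteq> vars k m"
proof
  fix v assume "v \<in> keys (tri_exp k m a)"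
  then show "v \<in> vars k m"
    by (cases v) (auto simp: in_keys_iff lookup_tri_exp vars_def split: if_splits)
qed

lemma var_mpoly_power: "var_mpoly v ^ N = single (single v N) 1"
  by (induction N) (auto simp: var_mpoly_def mult_single simp flip: single_add)

lemma prod_singles: "(\<Prod>i\<in>S. single (f i) 1) = (single (\<Sum>i\<in>S. f i) 1 :: _ \<Rightarrow>\<^sub>0 'a::comm_ring_1)"
  by (induction S rule: infinite_finite_induct) (auto simp: mult_single)

lemma trinomial_eq:
  "trinomial k m n a = single (tri_exp k m a) 1 - (single (single Vz n) 1 + 1)"
  unfolding trinomial_def tri_exp_def
  by (simp add: var_mpoly_power prod_singles mult_single) (simp add: var_mpoly_def prod_singles mult_single)

lemma keys_single_subset: "keys (single v e) \<subseteq> {v}"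
  by simp

lemma trinomial_mem: "trinomial k m n a \<in> mpolys k m"
  unfolding trinomial_eq
  by (intro mpolys_diff mpolys_add mpolys_single mpolys_one keys_tri_exp_subset)
    (use keys_single_subset in \<open>fastforce simp: vars_def\<close>)

definition reduced :: "nat \<Rightarrow> nat \<Rightarrow> nat \<Rightarrow> (var \<Rightarrow>\<^sub>0 nat) set" where
  "reduced k m n = {t. keys t \<subseteq> vars k m \<and> lookup t Vz < n}"

lemma split_Vz:
  assumes "n \<le> lookup (t :: var \<Rightarrow>\<^sub>0 nat) Vz"
  shows "t = (t - single Vz n) + single Vz n"
proof (rule poly_mapping_eqI)
  fix v
  show "lookup t v = lookup (t - single Vz n + single Vz n) v"
    using assms by (cases v) (auto simp: lookup_add lookup_minus lookup_single when_def)
qed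

lemma keys_minus_subset: "keys (t - s) \<subseteq> keys (t :: 'v \<Rightarrow>\<^sub>0 nat)"
  by (auto simp: in_keys_iff lookup_minus)

text \<open>
  Modulo the trinomial, \<open>z\<^sup>n\<close> may be replaced by \<open>M - 1\<close>, in which \<open>z\<close> does not occur.  This lowers the
  exponent of \<open>z\<close>, so it can be repeated until that exponent is below \<open>n\<close>.
\<close>

lemma reduce_monomial:
  fixes c :: "'a::field"
  assumes n: "n > 0" and t: "keys t \<subseteq> vars k m"
  shows "\<exists>q r. r \<in> mpolys k m \<and> keys q \<subseteq> reduced k m n \<and> single t c = q + r * trinomial k m n a"
  using t
proof (induction "lookup t Vz" arbitrary: t c rule: less_induct)
  case less
  show ?case
  proof (cases "lookup t Vz < n")
    case True
    then show ?thesis using less.prems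
      by (intro exI[of _ "single t c"] exI[of _ 0]) (auto simp: reduced_def mpolys_zero)
  next
    case False
    let ?t = "t - single Vz n" and ?f = "trinomial k m n a :: 'a mpoly"
    have t: "t = ?t + single Vz n" using False by (intro split_Vz) auto
    have z: "lookup ?t Vz < lookup t Vz" using False n by (simp add: lookup_minus)
    have kt: "keys ?t \<subseteq> vars k m" by (rule order_trans[OF keys_minus_subset less.prems])
    then have kt': "keys (?t + tri_exp k m a) \<subseteq> vars k m"
      using Poly_Mapping.keys_add[of ?t "tri_exp k m a"] keys_tri_exp_subset[of k m a] by (metis Un_least order_trans)
    have z': "lookup (?t + tri_exp k m a) Vz < lookup t Vz"
      using z by (simp add: lookup_add lookup_tri_exp)
    obtain q1 r1 where 1: "r1 \<in> mpolys k m" "keys q1 \<subseteq> reduced k m n"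
        "single (?t + tri_exp k m a) c = q1 + r1 * ?f"
      using less.hyps[OF z' kt'] by blast
    obtain q2 r2 where 2: "r2 \<in> mpolys k m" "keys q2 \<subseteq> reduced k m n" "single ?t c = q2 + r2 * ?f"
      using less.hyps[OF z kt] by blast
    have "single t c = single ?t c * single (single Vz n) 1"
      by (subst t) (simp add: mult_single)
    also have "single (single Vz n) 1 = single (tri_exp k m a) 1 - 1 - ?f"
      by (simp add: trinomial_eq)
    also have "single ?t c * \<dots> = single (?t + tri_exp k m a) c - single ?t c - single ?t c * ?f"
      by (simp add: algebra_simps mult_single)
    also have "\<dots> = (q1 - q2) + (r1 - r2 - single ?t c) * ?f"
      unfolding 1(3) by (simp add: 2(3) algebra_simps)
    finally have "single t c = (q1 - q2) + (r1 - r2 - single ?t c) * ?f" .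
    moreover have "r1 - r2 - single ?t c \<in> mpolys k m"
      by (intro mpolys_diff 1 2 mpolys_single kt)
    moreover have "keys (q1 - q2) \<subseteq> reduced k m n"
    proof
      fix x assume "x \<in> keys (q1 - q2)"
      then have "x \<in> keys q1 \<or> x \<in> keys q2" by (auto simp: in_keys_iff lookup_minus)
      then show "x \<in> reduced k m n" using 1(2) 2(2) by blast
    qed
    ultimately show ?thesis by blast
  qed
qed

lemma reduce_mpoly:
  fixes p :: "'a::field mpoly"
  assumes n: "n > 0" and p: "p \<in> mpolys k m"
  obtains q r where "r \<in> mpolys k m" "keys q \<subseteq> reduced k m n" "p = q + r * trinomial k m n a"
proof -
  have "\<forall>t\<in>keys p. \<exists>q r. r \<in> mpolys k m \<and> keys q \<subseteq> reduced k m n \<and>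
      single t (lookup p t) = q + r * trinomial k m n a"
    using p reduce_monomial[OF n] unfolding mpolys_iff by blast
  then obtain q r where qr: "r t \<in> mpolys k m" "keys (q t) \<subseteq> reduced k m n"
      "single t (lookup p t) = q t + r t * trinomial k m n a" if "t \<in> keys p" for t
    by metis
  have "p = (\<Sum>t\<in>keys p. q t + r t * trinomial k m n a)"
    using qr(3) sum_singles[of p] by (metis (no_types, lifting) sum.cong)
  then have "p = (\<Sum>t\<in>keys p. q t) + (\<Sum>t\<in>keys p. r t) * trinomial k m n a"
    by (simp add: sum.distrib sum_distrib_right)
  moreover have "keys (\<Sum>t\<in>keys p. q t) \<subseteq> reduced k m n"
    using Poly_Mapping.keys_sum qr(2) by fastforce
  ultimately show ?thesis using that qr(1) mpolys_sum by blast
qed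

section \<open>Models of the coordinate ring in a domain\<close>

text \<open>
  Equality of \<open>K\<close>-degrees, as a relation between exponent vectors: their difference is an integral
  combination of the two relations that define the group \<open>K\<close>.
\<close>

definition same_weight :: "nat \<Rightarrow> nat \<Rightarrow> nat \<Rightarrow> (nat \<Rightarrow> nat) \<Rightarrow> (var \<Rightarrow>\<^sub>0 nat) \<Rightarrow> (var \<Rightarrow>\<^sub>0 nat) \<Rightarrow> bool" where
  "same_weight k m n a s t \<longleftrightarrow> (\<exists>l q. \<forall>v. int (lookup s v) =
     int (lookup t v) + l * int (lookup (tri_exp k m a) v) + q * (if v = Vz then int n else 0))"

definition model_ring ::
    "('a::field \<Rightarrow> 'b) \<Rightarrow> (var \<Rightarrow> 'b::comm_ring_1) \<Rightarrow> nat \<Rightarrow> nat \<Rightarrow> 'b set" where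
  "model_ring \<iota> \<xi> k m = mpoly_eval \<iota> \<xi> ` mpolys k m"

text \<open>
  A point \<open>\<xi>\<close> of the hypersurface with values in a domain.  The assumption \<open>independent\<close> makes it
  generic: the evaluation \<open>\<phi>\<close> then has no kernel besides the trinomial ideal (lemma \<open>\<phi>_eq_0_iff\<close>), so its
  image \<open>B\<close> is a copy of the coordinate ring.
\<close>

locale trinomial_model = scalar_hom \<iota>
  for \<iota> :: "'a::field_char_0 \<Rightarrow> 'b::{idom, ring_char_0}" +
  fixes k m n :: nat and a :: "nat \<Rightarrow> nat" and \<xi> :: "var \<Rightarrow> 'b"
  assumes k: "k \<ge> 1" and n: "n \<ge> 2" and a: "\<And>s. s \<in> {1..m} \<Longrightarrow> a s > 1"
    and relation: "mon_eval \<xi> (tri_exp k m a) = \<xi> Vz ^ n + 1"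
    and independent: "\<And>p. keys p \<subseteq> reduced k m n \<Longrightarrow> mpoly_eval \<iota> \<xi> p = 0 \<Longrightarrow> p = 0"
begin

abbreviation "mval \<equiv> mon_eval \<xi>"
abbreviation "\<phi> \<equiv> mpoly_eval \<iota> \<xi>"
abbreviation "\<mu> \<equiv> tri_exp k m a"
abbreviation "z \<equiv> \<xi> Vz"
abbreviation "XY \<equiv> vars k m - {Vz}"

abbreviation "B \<equiv> model_ring \<iota> \<xi> k m"

lemma B_I: "p \<in> mpolys k m \<Longrightarrow> \<phi> p \<in> B"
  by (simp add: model_ring_def)

lemma B_E: assumes "b \<in> B" obtains p where "p \<in> mpolys k m" "b = \<phi> p"
  using assms by (auto simp: model_ring_def)

lemma scalar_mem: "\<iota> c \<in> B"
  using B_I[OF mpolys_single[of 0 k m c]] by simp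

lemma mon_mem: "keys t \<subseteq> vars k m \<Longrightarrow> mval t \<in> B"
  using B_I[OF mpolys_single[of t k m 1]] by (simp add: \<iota>_one)

lemma var_mem: "v \<in> vars k m \<Longrightarrow> \<xi> v \<in> B"
  using mon_mem[of "single v 1"] by simp

lemma B_add: "b \<in> B \<Longrightarrow> c \<in> B \<Longrightarrow> b + c \<in> B"
  by (metis B_E B_I mpoly_eval_add mpolys_add)

lemma B_mult: "b \<in> B \<Longrightarrow> c \<in> B \<Longrightarrow> b * c \<in> B"
  by (metis B_E B_I mpoly_eval_mult mpolys_mult)

lemma B_uminus: "b \<in> B \<Longrightarrow> - b \<in> B"
  by (metis B_E B_I mpoly_eval_uminus mpolys_uminus)

lemma B_one: "1 \<in> B"
  using scalar_mem[of 1] by (simp add: \<iota>_one)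

lemma Vz_mem: "Vz \<in> vars k m"
  by (simp add: vars_def)

lemma keys_\<mu>: "keys \<mu> = XY"
  using a by (rule keys_tri_exp)

lemma \<iota>_eq_0_iff: "\<iota> c = 0 \<longleftrightarrow> c = 0"
proof
  assume "\<iota> c = 0"
  then have "single (0 :: var \<Rightarrow>\<^sub>0 nat) c = 0"
    using n by (intro independent) (auto simp: reduced_def)
  then show "c = 0" by (metis lookup_single_eq lookup_zero)
qed (simp add: \<iota>_zero)

lemma var_nonzero:
  assumes "v \<in> vars k m" shows "\<xi> v \<noteq> 0"
proof
  assume "\<xi> v = 0"
  then have "single (single v (1::nat)) (1::'a) = 0"
    using n assms by (intro independent) (auto simp: reduced_def lookup_single when_def)
  then show False by (metis lookup_single_eq lookup_zero zero_neq_one)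
qed

lemma mon_nonzero: "keys t \<subseteq> vars k m \<Longrightarrow> mval t \<noteq> 0"
  unfolding mon_eval_def using var_nonzero by (auto simp: subset_iff)

lemma \<phi>_trinomial: "\<phi> (trinomial k m n a) = 0"
  by (simp add: trinomial_eq mpoly_eval_diff mpoly_eval_add \<iota>_one relation)

lemma reduced_rep:
  assumes "b \<in> B" obtains p where "keys p \<subseteq> reduced k m n" "b = \<phi> p"
proof -
  obtain p where p: "p \<in> mpolys k m" "b = \<phi> p" using assms by (rule B_E)
  obtain q r where "keys q \<subseteq> reduced k m n" "p = q + r * trinomial k m n a"
    using reduce_mpoly[OF _ p(1)] n by (metis less_le_trans pos2)
  then show ?thesis
    using that p(2) by (simp add: mpoly_eval_add mpoly_eval_mult \<phi>_trinomial)
qed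

lemma \<phi>_eq_0_iff:
  assumes "p \<in> mpolys k m"
  shows "\<phi> p = 0 \<longleftrightarrow> p \<in> trinomial_ideal k m n a"
proof
  assume 0: "\<phi> p = 0"
  obtain q r where qr: "r \<in> mpolys k m" "keys q \<subseteq> reduced k m n" "p = q + r * trinomial k m n a"
    using reduce_mpoly[OF _ assms] n by (metis less_le_trans pos2)
  then have "q = 0"
    using 0 by (intro independent) (auto simp: mpoly_eval_add mpoly_eval_mult \<phi>_trinomial)
  then show "p \<in> trinomial_ideal k m n a"
    using qr unfolding trinomial_ideal_def cgenideal_def by (auto simp: mpoly_ring_ops)
qed (auto simp: trinomial_ideal_def cgenideal_def mpoly_ring_ops mpoly_eval_mult \<phi>_trinomial)

lemma lookup_\<mu>_nonzero: "v \<in> XY \<Longrightarrow> lookup \<mu> v \<noteq> 0"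
  using keys_\<mu> by (metis in_keys_iff)

lemma \<mu>_split:
  assumes "j \<in> XY"
  shows "\<mu> = (\<mu> - single j 1) + single j 1"
proof (rule poly_mapping_eqI)
  fix v
  have "lookup \<mu> j \<noteq> 0" by (rule lookup_\<mu>_nonzero[OF assms])
  then show "lookup \<mu> v = lookup ((\<mu> - single j 1) + single j 1) v"
    by (auto simp: lookup_add lookup_minus lookup_single when_def)
qed

lemma mval_\<mu>_split: "j \<in> XY \<Longrightarrow> mval (\<mu> - single j 1) * \<xi> j = mval \<mu>"
  by (subst (2) \<mu>_split) (simp_all add: mon_eval_add)

text \<open>
  Since \<open>z\<^sup>n = M - 1\<close>, monomials of degree zero are polynomials in \<open>M\<close>.  Only the constant term \<open>c\<close> is made
  explicit, because a nonzero remaining part \<open>M G\<close> will be excluded by its degree alone.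
\<close>

lemma weight_zero_monomial_shape:
  "\<exists>c. \<exists>G\<in>B. mval \<mu> ^ l * z ^ (n * q) = \<iota> c + mval \<mu> * G"
proof -
  have \<mu>B: "mval \<mu> \<in> B" by (intro mon_mem keys_tri_exp_subset)
  have zn: "z ^ n = mval \<mu> - 1" using relation by simp
  have mult: "\<exists>c. \<exists>G\<in>B. b * b' = \<iota> c + mval \<mu> * G"
    if "\<exists>c. \<exists>G\<in>B. b = \<iota> c + mval \<mu> * G" "\<exists>c. \<exists>G\<in>B. b' = \<iota> c + mval \<mu> * G" for b b'
  proof -
    obtain c G c' G' where "G \<in> B" "G' \<in> B" "b = \<iota> c + mval \<mu> * G" "b' = \<iota> c' + mval \<mu> * G'"
      using \<open>\<exists>c. \<exists>G\<in>B. b = \<iota> c + mval \<mu> * G\<close> \<open>\<exists>c. \<exists>G\<in>B. b' = \<iota> c + mval \<mu> * G\<close> by blast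
    then have "b * b' = \<iota> (c * c') + mval \<mu> * (\<iota> c * G' + \<iota> c' * G + mval \<mu> * G * G')"
      "\<iota> c * G' + \<iota> c' * G + mval \<mu> * G * G' \<in> B"
      using \<mu>B by (auto simp: \<iota>_mult algebra_simps scalar_mem intro!: B_add B_mult)
    then show ?thesis by blast
  qed
  have pow: "\<exists>c. \<exists>G\<in>B. b ^ N = \<iota> c + mval \<mu> * G" if "\<exists>c. \<exists>G\<in>B. b = \<iota> c + mval \<mu> * G" for b N
  proof (induction N)
    case 0
    have "b ^ 0 = \<iota> 1 + mval \<mu> * \<iota> 0" by (simp add: \<iota>_one \<iota>_zero)
    then show ?case using scalar_mem by blast
  next
    case (Suc N)
    then show ?case using mult[OF that Suc] by simp
  qed
  have "mval \<mu> = \<iota> 0 + mval \<mu> * 1" "mval \<mu> - 1 = \<iota> (- 1) + mval \<mu> * 1"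
    by (simp_all add: \<iota>_zero \<iota>_uminus \<iota>_one)
  then have "\<exists>c. \<exists>G\<in>B. mval \<mu> = \<iota> c + mval \<mu> * G" "\<exists>c. \<exists>G\<in>B. mval \<mu> - 1 = \<iota> c + mval \<mu> * G"
    using B_one by blast+
  then have "\<exists>c. \<exists>G\<in>B. mval \<mu> ^ l * (mval \<mu> - 1) ^ q = \<iota> c + mval \<mu> * G"
    by (intro mult pow)
  then show ?thesis by (simp add: power_mult zn)
qed

text \<open>
  Up to powers of \<open>z\<^sup>n\<close>, monomials of the same weight differ by powers of \<open>M\<close>.  These powers are
  nonnegative if the comparison is with a monomial \<open>t1\<close> of least exponent in \<open>x\<^sub>1\<close>, because \<open>x\<^sub>1\<close> has
  exponent one in \<open>M\<close>.
\<close>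

lemma homogeneous_shape:
  assumes p: "p \<in> mpolys k m" "p \<noteq> 0"
    and same: "\<And>s t. s \<in> keys p \<Longrightarrow> t \<in> keys p \<Longrightarrow> same_weight k m n a s t"
  obtains s c G where "s \<in> reduced k m n" "G \<in> B" "\<phi> p = (\<iota> c + mval \<mu> * G) * mval s"
proof -
  have "keys p \<noteq> {}" using p by simp
  then obtain t1 where t1: "t1 \<in> keys p" "\<And>t. t \<in> keys p \<Longrightarrow> lookup t1 (Vx 1) \<le> lookup t (Vx 1)"
    using finite_keys ex_min_if_finite[of "(\<lambda>t. lookup t (Vx 1)) ` keys p"]
    by (metis (no_types, lifting) arg_min_if_finite(1) arg_min_least)
  define s where "s = Poly_Mapping.update Vz (lookup t1 Vz mod n) t1"
  have s: "lookup s v = (if v = Vz then lookup t1 Vz mod n else lookup t1 v)" for v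
    by (simp add: s_def lookup_update)
  have kt: "keys t \<subseteq> vars k m" if "t \<in> keys p" for t using p that by (auto simp: mpolys_iff)
  have sr: "s \<in> reduced k m n"
    using kt[OF t1(1)] n Vz_mem by (auto simp: reduced_def subset_iff in_keys_iff s split: if_splits)
  have key_shape: "\<exists>c. \<exists>G\<in>B. mval t = (\<iota> c + mval \<mu> * G) * mval s" if t: "t \<in> keys p" for t
  proof -
    obtain l q where lq: "\<And>v. int (lookup t v) = int (lookup t1 v) + l * int (lookup \<mu> v)
        + q * (if v = Vz then int n else 0)"
      using same[OF t t1(1)] unfolding same_weight_def by blast
    have "int (lookup t (Vx 1)) = int (lookup t1 (Vx 1)) + l"
      using lq[of "Vx 1"] k by (simp add: lookup_tri_exp)
    then have "l \<ge> 0" using t1(2)[OF t] by linarith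
    then obtain l' where l': "l = int l'" using nonneg_int_cases by blast
    have "int (lookup t Vz) mod int n = int (lookup t1 Vz) mod int n"
      using lq[of Vz] by (simp add: lookup_tri_exp)
    then have mod: "lookup t Vz mod n = lookup t1 Vz mod n"
      by (metis of_nat_eq_iff zmod_int)
    have t_eq: "t = s + (\<Sum>i<l'. \<mu>) + single Vz (n * (lookup t Vz div n))"
    proof (rule poly_mapping_eqI)
      fix v
      show "lookup t v = lookup (s + (\<Sum>i<l'. \<mu>) + single Vz (n * (lookup t Vz div n))) v"
      proof (cases "v = Vz")
        case True
        have "lookup t Vz = lookup t1 Vz mod n + n * (lookup t Vz div n)"
          unfolding mod[symmetric] by simp
        then show ?thesis using True by (simp add: lookup_add lookup_sum lookup_tri_exp s)
      next
        case False
        then have "int (lookup t v) = int (lookup t1 v + l' * lookup \<mu> v)" using lq[of v] l' by simp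
        then have "lookup t v = lookup t1 v + l' * lookup \<mu> v" by linarith
        then show ?thesis using False by (simp add: lookup_add lookup_sum lookup_single when_def s)
      qed
    qed
    have "mval t = mval s * (mval \<mu> ^ l' * z ^ (n * (lookup t Vz div n)))"
      by (subst t_eq) (simp add: mon_eval_add mon_eval_sum)
    then show ?thesis using weight_zero_monomial_shape[of l' "lookup t Vz div n"] by (metis mult.commute)
  qed
  then obtain c G where cG: "\<And>t. t \<in> keys p \<Longrightarrow> G t \<in> B"
      "\<And>t. t \<in> keys p \<Longrightarrow> mval t = (\<iota> (c t) + mval \<mu> * G t) * mval s"
    by metis
  have \<iota>_sum: "\<iota> (sum f S) = (\<Sum>i\<in>S. \<iota> (f i))" for f :: "(var \<Rightarrow>\<^sub>0 nat) \<Rightarrow> 'a" and S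
    by (induction S rule: infinite_finite_induct) (auto simp: \<iota>_zero \<iota>_add)
  have B_sum: "(\<And>i. i \<in> S \<Longrightarrow> f i \<in> B) \<Longrightarrow> sum f S \<in> B" for f :: "(var \<Rightarrow>\<^sub>0 nat) \<Rightarrow> 'b" and S
    using scalar_mem[of 0]
    by (induction S rule: infinite_finite_induct) (auto simp: \<iota>_zero intro: B_add)
  have "\<phi> p = (\<Sum>t\<in>keys p. \<iota> (lookup p t) * ((\<iota> (c t) + mval \<mu> * G t) * mval s))"
    unfolding mpoly_eval_def using cG(2) by (intro sum.cong) auto
  also have "\<dots> = (\<iota> (\<Sum>t\<in>keys p. lookup p t * c t) +
      mval \<mu> * (\<Sum>t\<in>keys p. \<iota> (lookup p t) * G t)) * mval s"
    by (simp add: \<iota>_sum \<iota>_mult sum_distrib_left sum_distrib_right distrib_right distrib_left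
        sum.distrib mult_ac)
  finally have "\<phi> p = \<dots>" .
  moreover have "(\<Sum>t\<in>keys p. \<iota> (lookup p t) * G t) \<in> B"
    using cG(1) by (intro B_sum B_mult scalar_mem)
  ultimately show ?thesis using that sr by blast
qed

end

section \<open>Degrees of the variables\<close>

locale trinomial_lnd = trinomial_model \<iota> k m n a \<xi> + lnd "model_ring \<iota> \<xi> k m" F
  for \<iota> :: "'a::field_char_0 \<Rightarrow> 'b::{idom, ring_char_0}" and k m n a \<xi> F +
  assumes F_scalar: "F (\<iota> c) = 0"
    and F_nonzero: "\<exists>b\<in>model_ring \<iota> \<xi> k m. F b \<noteq> 0"
begin

lemma mval_killed: "keys t \<subseteq> vars k m \<Longrightarrow> (\<And>v. v \<in> keys t \<Longrightarrow> F (\<xi> v) = 0) \<Longrightarrow> F (mval t) = 0"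
  unfolding mon_eval_def by (subst F_prod_powers) (auto intro: var_mem)

lemma poly_killed: "p \<in> mpolys k m \<Longrightarrow> (\<And>t. t \<in> keys p \<Longrightarrow> F (mval t) = 0) \<Longrightarrow> F (\<phi> p) = 0"
  unfolding mpoly_eval_def
  by (subst F_sum) (auto simp: mpolys_iff F_mult F_scalar scalar_mem mon_mem mult_mem)

lemma killed_if_generators_killed:
  assumes "\<And>v. v \<in> vars k m \<Longrightarrow> F (\<xi> v) = 0" "b \<in> B"
  shows "F b = 0"
proof -
  obtain p where p: "p \<in> mpolys k m" "b = \<phi> p" using assms(2) by (rule B_E)
  show ?thesis unfolding p(2)
  proof (rule poly_killed[OF p(1)])
    fix t assume "t \<in> keys p"
    then have "keys t \<subseteq> vars k m" using p by (auto simp: mpolys_iff)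
    then show "F (mval t) = 0" using assms(1) by (intro mval_killed) auto
  qed
qed

lemma ndeg_scalar: "ndeg (\<iota> c) = 0"
  by (simp add: ndeg_eq_0 scalar_mem F_scalar)

lemma ndeg_mval:
  "keys t \<subseteq> vars k m \<Longrightarrow> ndeg (mval t) = (\<Sum>v\<in>keys t. lookup t v * ndeg (\<xi> v))"
  unfolding mon_eval_def
  by (subst ndeg_prod) (auto simp: power_mem var_mem var_nonzero ndeg_power subset_iff intro!: sum.cong)

lemma ndeg_mval_ge:
  assumes "keys t \<subseteq> vars k m" shows "lookup t v * ndeg (\<xi> v) \<le> ndeg (mval t)"
proof (cases "v \<in> keys t")
  case True
  then show ?thesis unfolding ndeg_mval[OF assms] by (intro member_le_sum) auto
qed (simp add: in_keys_iff)

lemma \<mu>_vars: "keys \<mu> \<subseteq> vars k m"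
  by (rule keys_tri_exp_subset)

lemma var_killed_if_mval_killed:
  assumes t: "keys t \<subseteq> vars k m" and 0: "F (mval t) = 0" and v: "v \<in> keys t"
  shows "F (\<xi> v) = 0"
proof -
  have "ndeg (mval t) = 0" using ndeg_eq_0 0 t mon_mem by blast
  then have "lookup t v * ndeg (\<xi> v) = 0" using ndeg_mval_ge[OF t, of v] by simp
  then show ?thesis
    using v t ndeg_eq_0_iff[of "\<xi> v"] var_nonzero var_mem by (auto simp: in_keys_iff subset_iff)
qed

lemma z_mem: "z \<in> B"
  using var_mem Vz_mem by blast

lemma z_nonzero: "z \<noteq> 0"
  using var_nonzero Vz_mem by blast

text \<open>
  If \<open>z\<close> were killed, so would be \<open>M = z\<^sup>n + 1\<close> and with it all its factors, that is, all variables.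
\<close>

lemma F_z: "F z \<noteq> 0"
proof
  assume 0: "F z = 0"
  then have "F (mval \<mu>) = 0"
    unfolding relation by (simp add: F_add power_mem one_mem z_mem F_power F_one)
  then have "F (\<xi> v) = 0" if "v \<in> vars k m" for v
    using 0 var_killed_if_mval_killed[OF \<mu>_vars, of v] that keys_\<mu> by (cases "v = Vz") auto
  then show False using F_nonzero killed_if_generators_killed by blast
qed

lemma ndeg_z: "ndeg z > 0"
  using F_z ndeg_eq_0_iff[OF z_mem z_nonzero] by auto

lemma ndeg_\<mu>: "ndeg (mval \<mu>) = n * ndeg z"
proof -
  have "ndeg (z ^ n) = n * ndeg z" by (rule ndeg_power[OF z_mem z_nonzero])
  moreover have "0 < n * ndeg z" using ndeg_z n by simp
  ultimately show ?thesis unfolding relation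
    using ndeg_add_killed(1)[of 1 "z ^ n"] by (simp add: add.commute one_mem power_mem z_mem F_one)
qed

text \<open>
  If \<open>G \<noteq> 0\<close>, then \<open>c + M G\<close> has at least the degree \<open>n ndeg z\<close> of \<open>M\<close>.
\<close>

lemma homogeneous_low_degree:
  assumes p: "p \<in> mpolys k m" "\<phi> p \<noteq> 0"
    and same: "\<And>s t. s \<in> keys p \<Longrightarrow> t \<in> keys p \<Longrightarrow> same_weight k m n a s t"
    and deg: "ndeg (\<phi> p) < n * ndeg z"
  obtains s c where "s \<in> reduced k m n" "c \<noteq> 0" "\<phi> p = \<iota> c * mval s"
proof -
  have "p \<noteq> 0" using p by auto
  then obtain s c G where s: "s \<in> reduced k m n" "G \<in> B" "\<phi> p = (\<iota> c + mval \<mu> * G) * mval s"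
    by (rule homogeneous_shape[OF p(1) _ same])
  have ks: "keys s \<subseteq> vars k m" using s(1) by (simp add: reduced_def)
  have \<mu>: "mval \<mu> \<in> B" "mval \<mu> \<noteq> 0" using mon_mem mon_nonzero \<mu>_vars by blast+
  have G: "G = 0"
  proof (rule ccontr)
    assume nz: "G \<noteq> 0"
    then have "n * ndeg z \<le> ndeg (mval \<mu> * G)" by (simp add: \<mu> s ndeg_mult ndeg_\<mu>)
    moreover have "0 < n * ndeg z" using ndeg_z n by simp
    ultimately have pos: "0 < ndeg (mval \<mu> * G)" by linarith
    have "ndeg (\<iota> c + mval \<mu> * G) = ndeg (mval \<mu> * G)" "\<iota> c + mval \<mu> * G \<noteq> 0"
      using ndeg_add_killed[of "\<iota> c" "mval \<mu> * G"] pos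
      by (auto simp: scalar_mem F_scalar \<mu> s mult_mem)
    with \<open>n * ndeg z \<le> ndeg (mval \<mu> * G)\<close> have "n * ndeg z \<le> ndeg ((\<iota> c + mval \<mu> * G) * mval s)"
      by (simp add: ndeg_mult add_mem mult_mem scalar_mem \<mu> s mon_mem mon_nonzero ks)
    then show False using deg s(3) by simp
  qed
  then have eq: "\<phi> p = \<iota> c * mval s" using s(3) by simp
  then have "c \<noteq> 0" using p(2) by (auto simp: \<iota>_zero)
  then show ?thesis using that s(1) eq by blast
qed

end

section \<open>Homogeneous locally nilpotent derivations\<close>

locale homogeneous_lnd = trinomial_lnd \<iota> k m n a \<xi> D
  for \<iota> :: "'a::field_char_0 \<Rightarrow> 'b::{idom, ring_char_0}" and k m n a \<xi> D +
  assumes homogeneous: "v \<in> vars k m \<Longrightarrow>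
    \<exists>p\<in>mpolys k m. D (\<xi> v) = mpoly_eval \<iota> \<xi> p \<and>
      (\<forall>s\<in>keys p. \<forall>t\<in>keys p. same_weight k m n a s t)"
begin

text \<open>
  Each variable divides \<open>M\<close> or is \<open>z\<close>, so its degree is at most \<open>n ndeg z\<close>, and its image has smaller
  degree unless it is zero.
\<close>

lemma D_var_monomial:
  assumes v: "v \<in> vars k m"
  shows "\<exists>c s. s \<in> reduced k m n \<and> D (\<xi> v) = \<iota> c * mval s"
proof (cases "D (\<xi> v) = 0")
  case True
  then show ?thesis using n by (intro exI[of _ 0]) (auto simp: \<iota>_zero reduced_def)
next
  case False
  have "ndeg (\<xi> v) \<le> n * ndeg z"
  proof (cases "v = Vz")
    case True
    then show ?thesis using n by simp
  next
    case False
    then have "v \<in> keys \<mu>" using v keys_\<mu> by simp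
    then have "ndeg (\<xi> v) \<le> lookup \<mu> v * ndeg (\<xi> v)" by (simp add: in_keys_iff)
    then show ?thesis using ndeg_mval_ge[OF \<mu>_vars, of v] ndeg_\<mu> by linarith
  qed
  then have "ndeg (D (\<xi> v)) < n * ndeg z" using ndeg_F[OF var_mem[OF v] False] by simp
  then show ?thesis using homogeneous[OF v] homogeneous_low_degree False by metis
qed

lemma mval_minus:
  assumes "v \<in> XY"
  shows "mval (\<mu> - single v 1) = \<xi> v ^ (lookup \<mu> v - 1) * (\<Prod>w\<in>XY - {v}. \<xi> w ^ lookup \<mu> w)"
proof -
  have fin: "finite XY" by (simp add: finite_vars)
  have "mval (\<mu> - single v 1) = (\<Prod>w\<in>XY. \<xi> w ^ lookup (\<mu> - single v 1) w)"
    using keys_minus_subset[of \<mu> "single v 1"] keys_\<mu> fin by (intro mon_eval_superset) auto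
  also have "\<dots> = \<xi> v ^ lookup (\<mu> - single v 1) v * (\<Prod>w\<in>XY - {v}. \<xi> w ^ lookup (\<mu> - single v 1) w)"
    using fin assms by (rule prod.remove)
  also have "(\<Prod>w\<in>XY - {v}. \<xi> w ^ lookup (\<mu> - single v 1) w) = (\<Prod>w\<in>XY - {v}. \<xi> w ^ lookup \<mu> w)"
    by (intro prod.cong refl) (auto simp: lookup_minus lookup_single when_def)
  finally show ?thesis by (simp add: lookup_minus)
qed

lemma D_\<mu>: "D (mval \<mu>) = (\<Sum>v\<in>XY. of_nat (lookup \<mu> v) * mval (\<mu> - single v 1) * D (\<xi> v))"
proof -
  have "D (mval \<mu>) = D (\<Prod>v\<in>XY. \<xi> v ^ lookup \<mu> v)" by (simp add: mon_eval_def keys_\<mu>)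
  also have "\<dots> = (\<Sum>v\<in>XY. of_nat (lookup \<mu> v) * (\<xi> v ^ (lookup \<mu> v - 1) *
      (\<Prod>w\<in>XY - {v}. \<xi> w ^ lookup \<mu> w)) * D (\<xi> v))"
    by (rule F_prod_powers) (auto simp: finite_vars var_mem)
  also have "\<dots> = (\<Sum>v\<in>XY. of_nat (lookup \<mu> v) * mval (\<mu> - single v 1) * D (\<xi> v))"
    by (intro sum.cong refl) (simp only: mval_minus)
  finally show ?thesis .
qed

text \<open>
  Comparison of coefficients in \<open>D M = n z\<^bsup>n-1\<^esup> D z\<close>.  The monomial on the right occurs on the left in a
  term \<open>P D x\<^sub>j\<close>, where \<open>P = M / x\<^sub>j\<close>, which makes \<open>x\<^sub>j\<close> carry almost all the degree of \<open>M\<close>.  The remaining terms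
  contain no \<open>z\<close>, so they cancel among themselves, which means \<open>D P = 0\<close>.
\<close>

theorem shape_of_homogeneous_lnd:
  obtains j h where "j \<in> XY" "lookup \<mu> j = 1"
    "\<And>w. w \<in> XY - {j} \<Longrightarrow> D (\<xi> w) = 0"
    "h \<in> B" "h \<noteq> 0" "D z = mval (\<mu> - single j 1) * h" "D (D z) = 0"
proof -
  have "\<forall>v. \<exists>cs. v \<in> vars k m \<longrightarrow> snd cs \<in> reduced k m n \<and> D (\<xi> v) = \<iota> (fst cs) * mval (snd cs)"
    using D_var_monomial by simp
  from choice[OF this] obtain ct where ct:
    "\<forall>v. v \<in> vars k m \<longrightarrow> snd (ct v) \<in> reduced k m n \<and> D (\<xi> v) = \<iota> (fst (ct v)) * mval (snd (ct v))"
    by (rule exE)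
  define c where "c v = fst (ct v)" for v
  define t where "t v = snd (ct v)" for v
  have t: "t v \<in> reduced k m n" and D: "D (\<xi> v) = \<iota> (c v) * mval (t v)" if "v \<in> vars k m" for v
    using ct that by (simp_all add: c_def t_def)
  have tk: "keys (t v) \<subseteq> vars k m" if "v \<in> vars k m" for v
    using t[OF that] by (simp add: reduced_def)
  have deg_t: "ndeg (\<xi> v) = Suc (ndeg (mval (t v)))" if v: "v \<in> vars k m" "c v \<noteq> 0" for v
  proof -
    have "D (\<xi> v) \<noteq> 0" using v by (simp add: D \<iota>_eq_0_iff mon_nonzero tk)
    then show ?thesis using v ndeg_F[of "\<xi> v"]
      by (simp add: D var_mem ndeg_mult scalar_mem mon_mem tk mon_nonzero \<iota>_eq_0_iff ndeg_scalar)
  qed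
  have cz: "c Vz \<noteq> 0" using F_z D[OF Vz_mem] by (auto simp: \<iota>_zero)
  have tz: "lookup (t Vz) Vz = 0"
    using ndeg_mval_ge[OF tk[OF Vz_mem], of Vz] deg_t[OF Vz_mem cz]
    by (cases "lookup (t Vz) Vz") auto
  define T where "T = single Vz (n - 1) + t Vz"
  define e where "e v = \<mu> - single v 1 + t v" for v
  \<comment> \<open>A polynomial reduced in \<open>z\<close> whose value is \<open>D M - n z\<^bsup>n-1\<^esup> D z = 0\<close>.\<close>
  define q where "q = (\<Sum>v\<in>XY. single (e v) (of_nat (lookup \<mu> v) * c v)) - single T (of_nat n * c Vz)"
  have e_z: "lookup (e v) Vz = lookup (t v) Vz" if "v \<in> XY" for v
    using that by (auto simp: e_def lookup_add lookup_minus lookup_tri_exp)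
  have \<mu>v: "keys (\<mu> - single v 1) \<subseteq> vars k m" for v
    using keys_minus_subset \<mu>_vars by (rule order_trans)
  have e_red: "e v \<in> reduced k m n" if "v \<in> XY" for v
    using that t[of v] e_z[OF that] \<mu>v[of v] Poly_Mapping.keys_add[of "\<mu> - single v 1" "t v"]
    unfolding reduced_def e_def by auto
  have T_red: "T \<in> reduced k m n"
    using tz n Vz_mem tk[OF Vz_mem] Poly_Mapping.keys_add[of "single Vz (n - 1)" "t Vz"]
      keys_single_subset[of Vz "n - 1"]
    unfolding reduced_def T_def by (auto simp: lookup_add)
  have \<phi>_term: "\<phi> (single (e v) (of_nat (lookup \<mu> v) * c v)) =
      of_nat (lookup \<mu> v) * mval (\<mu> - single v 1) * D (\<xi> v)" if "v \<in> XY" for v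
    using that by (simp add: D e_def mon_eval_add \<iota>_mult \<iota>_of_nat)
  have "q = 0"
  proof (rule independent)
    have "keys (\<Sum>v\<in>XY. single (e v) (of_nat (lookup \<mu> v) * c v)) \<subseteq> reduced k m n"
      using Poly_Mapping.keys_sum[of "\<lambda>v. single (e v) (of_nat (lookup \<mu> v) * c v)" XY] e_red
      by (auto split: if_splits)
    then show "keys q \<subseteq> reduced k m n"
      using T_red unfolding q_def
      by (auto simp: in_keys_iff lookup_minus lookup_single when_def split: if_splits)
    have "D (mval \<mu>) = of_nat n * z ^ (n - 1) * D z"
      unfolding relation by (simp add: F_add power_mem one_mem z_mem F_power F_one)
    then show "\<phi> q = 0"
      unfolding q_def D_\<mu>
      by (simp add: mpoly_eval_diff mpoly_eval_sum \<phi>_term T_def mon_eval_add \<iota>_mult \<iota>_of_nat D Vz_mem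
          del: mpoly_eval_single) (simp add: mon_eval_add \<iota>_mult \<iota>_of_nat)
  qed
  \<comment> \<open>The monomial \<open>T\<close> of \<open>n z\<^bsup>n-1\<^esup> D z\<close> has to come from some variable \<open>j\<close>.\<close>
  have "lookup (\<Sum>v\<in>XY. single (e v) (of_nat (lookup \<mu> v) * c v)) T = of_nat n * c Vz"
    using arg_cong[OF \<open>q = 0\<close>, of "\<lambda>q. lookup q T"] by (simp add: q_def lookup_minus)
  then have "(\<Sum>v\<in>XY. lookup (single (e v) (of_nat (lookup \<mu> v) * c v)) T) \<noteq> 0"
    using cz n by (simp add: lookup_sum)
  then obtain j where j: "j \<in> XY" "lookup (single (e j) (of_nat (lookup \<mu> j) * c j)) T \<noteq> 0"
    by (meson sum.not_neutral_contains_not_neutral)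
  then have eT: "e j = T" and cj: "c j \<noteq> 0" by (auto simp: lookup_single when_def split: if_splits)
  have jv: "j \<in> vars k m" using j by simp
  let ?P = "mval (\<mu> - single j 1)" and ?d = "ndeg z"
  have P: "?P \<in> B" "?P \<noteq> 0" using mon_mem mon_nonzero \<mu>v by blast+
  have P_mult: "?P * \<xi> j = mval \<mu>"
    using arg_cong[OF \<mu>_split[OF j(1)], of mval] by (simp add: mon_eval_add)
  have tj_z: "lookup (t j) Vz = n - 1"
    using e_z[OF j(1)] tz by (simp add: eT T_def lookup_add)
  define x where "x = (n - 1) * ?d"
  have nd: "n * ?d = x + ?d" using n by (cases n) (auto simp: x_def)
  have "1 \<le> n - 1" using n by linarith
  then have dx: "?d \<le> x" unfolding x_def using mult_le_mono1[of 1 "n - 1" ?d] by linarith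
  have deg_j: "x + 1 \<le> ndeg (\<xi> j)"
    using ndeg_mval_ge[OF tk[OF jv], of Vz] deg_t[OF jv cj] tj_z by (simp add: x_def)
  \<comment> \<open>If \<open>x\<^sub>j\<^sup>2\<close> divided \<open>M\<close>, then \<open>2 (n - 1) ndeg z < n ndeg z\<close>, which contradicts \<open>n \<ge> 2\<close>.\<close>
  have \<mu>j: "lookup \<mu> j = 1"
  proof (rule ccontr)
    assume "lookup \<mu> j \<noteq> 1"
    moreover have "lookup \<mu> j \<noteq> 0" by (rule lookup_\<mu>_nonzero[OF j(1)])
    ultimately have "2 \<le> lookup \<mu> j" by linarith
    then have "2 * ndeg (\<xi> j) \<le> lookup \<mu> j * ndeg (\<xi> j)" by (rule mult_le_mono1)
    also have "\<dots> \<le> n * ?d" using ndeg_mval_ge[OF \<mu>_vars, of j] ndeg_\<mu> by simp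
    finally show False using deg_j nd dx by linarith
  qed
  have deg_P: "ndeg ?P + ndeg (\<xi> j) = n * ?d"
    using ndeg_mult[OF P(1) var_mem[OF jv] P(2) var_nonzero[OF jv]] P_mult ndeg_\<mu> by simp
  then have P_small: "ndeg ?P < ?d" using deg_j nd by linarith
  \<comment> \<open>The other variables divide \<open>P\<close>, so their degrees are below that of \<open>z\<close>.\<close>
  have t_no_z: "lookup (t w) Vz = 0" if w: "w \<in> XY - {j}" "c w \<noteq> 0" for w
  proof -
    have wv: "w \<in> vars k m" using w by simp
    have "lookup (\<mu> - single j 1) w = lookup \<mu> w" using w by (auto simp: lookup_minus lookup_single when_def)
    moreover have "lookup \<mu> w \<noteq> 0" using w by (intro lookup_\<mu>_nonzero) simp
    ultimately have "ndeg (\<xi> w) \<le> lookup (\<mu> - single j 1) w * ndeg (\<xi> w)" by simp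
    also have "\<dots> \<le> ndeg ?P" by (rule ndeg_mval_ge[OF \<mu>v])
    finally have "ndeg (mval (t w)) < ?d" using P_small deg_t[OF wv w(2)] by simp
    then have "lookup (t w) Vz * ?d < ?d"
      using ndeg_mval_ge[OF tk[OF wv], of Vz] by linarith
    then show ?thesis by (cases "lookup (t w) Vz") auto
  qed
  \<comment> \<open>The part of \<open>q\<close> without \<open>z\<close>; its value is \<open>x\<^sub>j D P\<close>.\<close>
  define R where "R = (\<Sum>v\<in>XY - {j}. single (e v) (of_nat (lookup \<mu> v) * c v))"
  have q_split: "q = R + (single T (c j) - single T (of_nat n * c Vz))"
    unfolding q_def R_def using sum.remove[of XY j "\<lambda>v. single (e v) (of_nat (lookup \<mu> v) * c v)"] j(1)
    by (simp add: finite_vars eT \<mu>j)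
  have R_keys: "lookup s Vz = 0" if "s \<in> keys R" for s
  proof -
    have "s \<in> (\<Union>v\<in>XY - {j}. keys (single (e v) (of_nat (lookup \<mu> v) * c v)))"
      using that Poly_Mapping.keys_sum unfolding R_def by fastforce
    then obtain v where "v \<in> XY - {j}" "s = e v" "c v \<noteq> 0" by (auto split: if_splits)
    then show ?thesis using t_no_z e_z by auto
  qed
  have "lookup T Vz \<noteq> 0" using n by (simp add: T_def lookup_add)
  have "R = 0"
  proof (rule ccontr)
    assume "R \<noteq> 0"
    then obtain s where s: "s \<in> keys R" by fastforce
    then have "s \<noteq> T" using R_keys \<open>lookup T Vz \<noteq> 0\<close> by auto
    then have "lookup q s = lookup R s" by (simp add: q_split lookup_add lookup_minus lookup_single when_def)
    then show False using s \<open>q = 0\<close> by (auto simp: in_keys_iff)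
  qed
  have "D (mval \<mu>) = D ?P * \<xi> j + ?P * D (\<xi> j)"
    unfolding P_mult[symmetric] using P(1) var_mem[OF jv] by (rule F_mult)
  moreover have "D (mval \<mu>) = \<phi> R + ?P * D (\<xi> j)"
    unfolding D_\<mu> R_def using sum.remove[of XY j "\<lambda>v. of_nat (lookup \<mu> v) * mval (\<mu> - single v 1) * D (\<xi> v)"] j(1)
    by (simp add: finite_vars \<mu>j mpoly_eval_sum \<phi>_term del: mpoly_eval_single)
  ultimately have "D ?P = 0" using \<open>R = 0\<close> var_nonzero[OF jv] by simp
  have killed: "D (\<xi> w) = 0" if w: "w \<in> XY - {j}" for w
  proof (rule var_killed_if_mval_killed[OF \<mu>v \<open>D ?P = 0\<close>])
    have "lookup \<mu> w \<noteq> 0" using w by (intro lookup_\<mu>_nonzero) simp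
    then show "w \<in> keys (\<mu> - single j 1)" using w by (auto simp: in_keys_iff lookup_minus lookup_single when_def)
  qed
  have deg_j': "ndeg (\<xi> j) = n * ?d" using deg_P ndeg_eq_0[OF P(1) \<open>D ?P = 0\<close>] by simp
  have tz_j: "lookup (t Vz) j = 0"
  proof (rule ccontr)
    assume "lookup (t Vz) j \<noteq> 0"
    then have "ndeg (\<xi> j) \<le> lookup (t Vz) j * ndeg (\<xi> j)" by simp
    also have "\<dots> \<le> ndeg (mval (t Vz))" by (rule ndeg_mval_ge[OF tk[OF Vz_mem]])
    finally have "n * ?d < ?d" using deg_t[OF Vz_mem cz] deg_j' by simp
    then show False using n by simp
  qed
  have "D (mval (t Vz)) = 0"
  proof (rule mval_killed[OF tk[OF Vz_mem]])
    fix v assume v: "v \<in> keys (t Vz)"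
    then have "v \<noteq> j" "v \<noteq> Vz" using tz tz_j by (auto simp: in_keys_iff)
    then show "D (\<xi> v) = 0" using killed tk[OF Vz_mem] v by auto
  qed
  then have DDz: "D (D z) = 0"
    by (simp add: D Vz_mem F_mult scalar_mem mon_mem tk F_scalar)
  \<comment> \<open>Cancelling \<open>z\<^bsup>n-1\<^esup>\<close> in \<open>P mval (t j) = z\<^bsup>n-1\<^esup> mval (t Vz)\<close> shows that \<open>P\<close> divides \<open>D z\<close>.\<close>
  define s where "s = t j - single Vz (n - 1)"
  have tj: "t j = s + single Vz (n - 1)"
    unfolding s_def by (rule split_Vz) (simp add: tj_z)
  have "(\<mu> - single j 1 + s) + single Vz (n - 1) = t Vz + single Vz (n - 1)"
    using eT unfolding e_def T_def by (subst (asm) tj) (simp add: ac_simps)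
  then have tz_eq: "t Vz = \<mu> - single j 1 + s" by simp
  have sk: "keys s \<subseteq> vars k m"
    unfolding s_def by (rule order_trans[OF keys_minus_subset tk[OF jv]])
  show ?thesis
  proof (rule that[OF j(1) \<mu>j killed _ _ _ DDz])
    show "\<iota> (c Vz) * mval s \<in> B" by (intro mult_mem scalar_mem mon_mem sk)
    show "\<iota> (c Vz) * mval s \<noteq> 0" using cz by (simp add: \<iota>_eq_0_iff mon_nonzero sk)
    show "D z = ?P * (\<iota> (c Vz) * mval s)" by (simp add: D Vz_mem tz_eq mon_eval_add)
  qed
qed

end

section \<open>Derivations that kill all variables but two\<close>

context trinomial_model
begin

text \<open>
  The polynomial ring in the variables other than \<open>z\<close> and \<open>j\<close>; it is denoted \<open>A\<close> in the comments.
\<close>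

definition coeff_ring :: "var \<Rightarrow> 'b set" where
  "coeff_ring j = \<phi> ` {p. \<forall>t\<in>keys p. keys t \<subseteq> XY - {j}}"

lemma coeff_ring_subset: "coeff_ring j \<subseteq> B"
  unfolding coeff_ring_def model_ring_def by (intro image_mono subsetI, unfold mpolys_iff mem_Collect_eq) blast

lemma coeff_ring_add: "b \<in> coeff_ring j \<Longrightarrow> c \<in> coeff_ring j \<Longrightarrow> b + c \<in> coeff_ring j"
proof -
  assume "b \<in> coeff_ring j" "c \<in> coeff_ring j"
  then obtain p q where pq: "b = \<phi> p" "c = \<phi> q" "\<forall>t\<in>keys p. keys t \<subseteq> XY - {j}" "\<forall>t\<in>keys q. keys t \<subseteq> XY - {j}"
    unfolding coeff_ring_def by blast
  then have "\<forall>t\<in>keys (p + q). keys t \<subseteq> XY - {j}" using Poly_Mapping.keys_add[of p q] by blast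
  then show ?thesis unfolding coeff_ring_def using pq(1,2)
    by (intro image_eqI[of _ _ "p + q"]) (auto simp: mpoly_eval_add)
qed

lemma coeff_ring_term: "keys t \<subseteq> XY - {j} \<Longrightarrow> \<iota> c * mval t \<in> coeff_ring j"
  unfolding coeff_ring_def by (intro image_eqI[of _ _ "single t c"]) auto

end

locale trinomial_lnd_killing = trinomial_lnd +
  fixes j
  assumes j: "j \<in> XY" "lookup \<mu> j = 1"
    and killed: "w \<in> XY - {j} \<Longrightarrow> F (\<xi> w) = 0"
begin

lemma coeff_ring_killed: "b \<in> coeff_ring j \<Longrightarrow> F b = 0"
proof -
  assume "b \<in> coeff_ring j"
  then obtain p where p: "b = \<phi> p" "\<And>t. t \<in> keys p \<Longrightarrow> keys t \<subseteq> XY - {j}" unfolding coeff_ring_def by blast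
  show ?thesis unfolding p(1)
  proof (rule poly_killed)
    show "p \<in> mpolys k m" using p(2) by (auto simp: mpolys_iff)
    show "F (mval t) = 0" if "t \<in> keys p" for t
      using p(2)[OF that] by (intro mval_killed killed) auto
  qed
qed

lemma coeff_ring_mem: "b \<in> coeff_ring j \<Longrightarrow> b \<in> B"
  using coeff_ring_subset by blast

text \<open>
  The cofactor \<open>M / x\<^sub>j\<close> is killed, so \<open>x\<^sub>j\<close> has the degree of \<open>M\<close>.
\<close>

lemma ndeg_j: "ndeg (\<xi> j) = n * ndeg z"
proof -
  have kP: "keys (\<mu> - single j 1) \<subseteq> XY - {j}"
    using keys_minus_subset[of \<mu> "single j 1"] keys_\<mu> j(2)
    by (auto simp: in_keys_iff lookup_minus lookup_single when_def split: if_splits)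
  then have kP': "keys (\<mu> - single j 1) \<subseteq> vars k m" by blast
  let ?P = "mval (\<mu> - single j 1)"
  have "F ?P = 0" using kP by (intro mval_killed[OF kP'] killed) auto
  then have "ndeg ?P = 0" using ndeg_eq_0 mon_mem kP' by blast
  moreover have "ndeg (?P * \<xi> j) = ndeg ?P + ndeg (\<xi> j)"
    using j(1) by (intro ndeg_mult mon_mem kP' mon_nonzero var_mem var_nonzero) auto
  ultimately show ?thesis using mval_\<mu>_split[OF j(1)] ndeg_\<mu> by simp
qed

lemma j_facts: "\<xi> j \<in> B" "\<xi> j \<noteq> 0"
  using j(1) var_mem var_nonzero by auto

lemma iter_low:
  assumes "b \<in> B" "b = 0 \<or> ndeg b < N"
  shows "(F ^^ N) b = 0"
  using assms iter_eq_0_iff[of b N] iter_zero by auto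

lemma iter_linear:
  assumes "\<beta> \<in> coeff_ring j" "\<gamma> \<in> coeff_ring j" "ndeg z < N"
  shows "(F ^^ N) (\<beta> + \<gamma> * z) = 0"
proof -
  have "(F ^^ N) \<beta> = 0"
    using assms ndeg_eq_0[OF coeff_ring_mem coeff_ring_killed] by (intro iter_low coeff_ring_mem) auto
  moreover have "(F ^^ N) (\<gamma> * z) = 0"
  proof (rule iter_low)
    show "\<gamma> * z \<in> B" using assms by (intro mult_mem coeff_ring_mem z_mem)
    show "\<gamma> * z = 0 \<or> ndeg (\<gamma> * z) < N"
      using assms ndeg_eq_0[OF coeff_ring_mem coeff_ring_killed, of \<gamma>]
      by (cases "\<gamma> = 0") (simp_all add: ndeg_mult coeff_ring_mem z_mem z_nonzero)
  qed
  ultimately show ?thesis using assms by (simp add: iter_add coeff_ring_mem mult_mem z_mem)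
qed

text \<open>
  Over \<open>A\<close>, the ring \<open>B\<close> is generated by the elements \<open>z\<^sup>i x\<^sub>j\<^sup>l\<close> with \<open>i < n\<close>.  Here the terms with \<open>l > 0\<close> are
  collected in \<open>x\<^sub>j G\<close> and those with \<open>l = 0\<close> in the bracket, where the bound \<open>i < n\<close> is recorded as
  a bound on the degree.
\<close>

definition has_z_expansion :: "'b \<Rightarrow> bool" where
  "has_z_expansion b \<longleftrightarrow> (\<exists>\<beta>\<in>coeff_ring j. \<exists>\<gamma>\<in>coeff_ring j. \<exists>H\<in>B. \<exists>G\<in>B. b = (\<beta> + \<gamma> * z + z\<^sup>2 * H) + \<xi> j * G \<and>
     (F ^^ (n * ndeg z)) (\<beta> + \<gamma> * z + z\<^sup>2 * H) = 0)"

lemma has_z_expansion_add: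
  assumes "has_z_expansion b" "has_z_expansion b'" shows "has_z_expansion (b + b')"
proof -
  obtain \<beta> \<gamma> H G where 1: "\<beta> \<in> coeff_ring j" "\<gamma> \<in> coeff_ring j" "H \<in> B" "G \<in> B" "b = (\<beta> + \<gamma> * z + z\<^sup>2 * H) + \<xi> j * G"
      "(F ^^ (n * ndeg z)) (\<beta> + \<gamma> * z + z\<^sup>2 * H) = 0"
    using assms(1) unfolding has_z_expansion_def by blast
  obtain \<beta>' \<gamma>' H' G' where 2: "\<beta>' \<in> coeff_ring j" "\<gamma>' \<in> coeff_ring j" "H' \<in> B" "G' \<in> B"
      "b' = (\<beta>' + \<gamma>' * z + z\<^sup>2 * H') + \<xi> j * G'"
      "(F ^^ (n * ndeg z)) (\<beta>' + \<gamma>' * z + z\<^sup>2 * H') = 0"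
    using assms(2) unfolding has_z_expansion_def by blast
  have eq: "(\<beta> + \<beta>') + (\<gamma> + \<gamma>') * z + z\<^sup>2 * (H + H') =
      (\<beta> + \<gamma> * z + z\<^sup>2 * H) + (\<beta>' + \<gamma>' * z + z\<^sup>2 * H')"
    by (simp add: algebra_simps)
  have "b + b' = ((\<beta> + \<beta>') + (\<gamma> + \<gamma>') * z + z\<^sup>2 * (H + H')) + \<xi> j * (G + G')"
    unfolding 1(5) 2(5) eq by (simp add: algebra_simps)
  moreover have "(F ^^ (n * ndeg z)) ((\<beta> + \<beta>') + (\<gamma> + \<gamma>') * z + z\<^sup>2 * (H + H')) = 0"
    unfolding eq using 1(6) 2(6) 1(3) 2(3) coeff_ring_mem[OF 1(1)] coeff_ring_mem[OF 1(2)] coeff_ring_mem[OF 2(1)] coeff_ring_mem[OF 2(2)]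
    by (subst iter_add) (auto intro!: add_mem mult_mem z_mem power_mem)
  moreover have "\<beta> + \<beta>' \<in> coeff_ring j" "\<gamma> + \<gamma>' \<in> coeff_ring j" "H + H' \<in> B" "G + G' \<in> B"
    using 1 2 by (auto intro: coeff_ring_add add_mem)
  ultimately show ?thesis unfolding has_z_expansion_def by blast
qed

lemma coeff_ring_zero: "0 \<in> coeff_ring j"
  using coeff_ring_term[of 0 j 0] by (simp add: \<iota>_zero)

lemma has_z_expansion_term:
  assumes t: "t \<in> reduced k m n"
  shows "has_z_expansion (\<iota> c * mval t)"
proof (cases "lookup t j = 0")
  case False
  let ?t = "t - single j 1"
  have "t = ?t + single j 1"
    by (rule poly_mapping_eqI) (use False in \<open>auto simp: lookup_add lookup_minus lookup_single when_def\<close>)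
  then have "mval t = mval ?t * \<xi> j" by (metis mon_eval_add mon_eval_single power_one_right)
  then have "\<iota> c * mval t = (0 + 0 * z + z\<^sup>2 * 0) + \<xi> j * (\<iota> c * mval ?t)" by simp
  moreover have "keys ?t \<subseteq> vars k m"
    using t keys_minus_subset[of t "single j 1"] unfolding reduced_def by blast
  then have "\<iota> c * mval ?t \<in> B" by (intro mult_mem scalar_mem mon_mem)
  moreover have "(F ^^ (n * ndeg z)) (0 + 0 * z + z\<^sup>2 * 0) = 0" by (simp add: iter_zero)
  ultimately show ?thesis unfolding has_z_expansion_def using coeff_ring_zero zero_mem by blast
next
  case True
  let ?i = "lookup t Vz"
  let ?t = "t - single Vz ?i"
  have i: "?i < n" using t by (simp add: reduced_def)
  have tt: "t = ?t + single Vz ?i" by (rule split_Vz) simp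
  then have mt: "mval t = mval ?t * z ^ ?i" by (metis mon_eval_add mon_eval_single)
  have kt: "keys ?t \<subseteq> XY - {j}"
    using t True unfolding reduced_def
    by (auto simp: in_keys_iff subset_iff lookup_minus lookup_single when_def split: if_splits)
  define \<beta> where "\<beta> = \<iota> c * mval ?t"
  have \<beta>: "\<beta> \<in> coeff_ring j" unfolding \<beta>_def using kt by (rule coeff_ring_term)
  have eq: "\<iota> c * mval t = \<beta> * z ^ ?i" by (simp add: \<beta>_def mt)
  have nil: "(F ^^ (n * ndeg z)) (\<beta> * z ^ ?i) = 0"
  proof (rule iter_low)
    show "\<beta> * z ^ ?i \<in> B" using \<beta> by (intro mult_mem coeff_ring_mem power_mem z_mem)
    have "?i * ndeg z < n * ndeg z" using i ndeg_z by simp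
    then show "\<beta> * z ^ ?i = 0 \<or> ndeg (\<beta> * z ^ ?i) < n * ndeg z"
      using \<beta> ndeg_eq_0[OF coeff_ring_mem coeff_ring_killed, of \<beta>]
      by (cases "\<beta> = 0") (simp_all add: ndeg_mult coeff_ring_mem power_mem z_mem z_nonzero ndeg_power)
  qed
  consider "?i = 0" | "?i = 1" | l where "?i = 2 + l"
    by (metis One_nat_def Suc_1 add_2_eq_Suc not0_implies_Suc)
  then obtain \<beta>' \<gamma> H where "\<beta>' \<in> coeff_ring j" "\<gamma> \<in> coeff_ring j" "H \<in> B" and eq': "\<beta> * z ^ ?i = \<beta>' + \<gamma> * z + z\<^sup>2 * H"
  proof cases
    case 1
    show ?thesis using \<beta> coeff_ring_zero zero_mem 1 by (intro that[of \<beta> 0 0]) auto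
  next
    case 2
    show ?thesis using \<beta> coeff_ring_zero zero_mem 2 by (intro that[of 0 \<beta> 0]) auto
  next
    case 3
    show ?thesis
    proof (rule that[of 0 0 "\<beta> * z ^ l"])
      show "\<beta> * z ^ l \<in> B" using coeff_ring_mem[OF \<beta>] by (intro mult_mem power_mem z_mem)
      show "\<beta> * z ^ ?i = 0 + 0 * z + z\<^sup>2 * (\<beta> * z ^ l)" unfolding 3 by (simp add: power_add power2_eq_square)
    qed (rule coeff_ring_zero)+
  qed
  moreover have "\<beta> * z ^ ?i = (\<beta>' + \<gamma> * z + z\<^sup>2 * H) + \<xi> j * 0" using eq' by simp
  ultimately show ?thesis unfolding has_z_expansion_def eq using zero_mem nil by metis
qed

lemma z_expansion_exists:
  assumes "b \<in> B" shows "has_z_expansion b"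
proof -
  obtain p where p: "keys p \<subseteq> reduced k m n" "b = \<phi> p" using assms by (rule reduced_rep)
  have "S \<subseteq> reduced k m n \<Longrightarrow> has_z_expansion (\<Sum>t\<in>S. \<iota> (lookup p t) * mval t)" if "finite S" for S
    using that
  proof (induction S rule: finite_induct)
    case empty
    then show ?case using has_z_expansion_term[of 0 0] n by (simp add: \<iota>_zero reduced_def)
  next
    case (insert t S)
    then show ?case by (simp add: has_z_expansion_add has_z_expansion_term)
  qed
  then show ?thesis using p by (simp add: mpoly_eval_def)
qed

text \<open>
  A nonzero \<open>x\<^sub>j G\<close> has degree at least \<open>n ndeg z\<close>, which exceeds the degrees of \<open>b\<close> and of the bracket in
  its expansion.  So \<open>G = 0\<close>, and then \<open>H = 0\<close> because \<open>z\<^sup>2 H\<close> would have degree at least \<open>2 ndeg z\<close>.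
\<close>

lemma linear_of_low_degree:
  assumes b: "b \<in> B" "(F ^^ Suc (ndeg z)) b = 0"
  obtains \<beta> \<gamma> where "\<beta> \<in> coeff_ring j" "\<gamma> \<in> coeff_ring j" "b = \<beta> + \<gamma> * z"
proof -
  let ?d = "ndeg z"
  obtain \<beta> \<gamma> H G where e: "\<beta> \<in> coeff_ring j" "\<gamma> \<in> coeff_ring j" "H \<in> B" "G \<in> B" "b = (\<beta> + \<gamma> * z + z\<^sup>2 * H) + \<xi> j * G"
      "(F ^^ (n * ?d)) (\<beta> + \<gamma> * z + z\<^sup>2 * H) = 0"
    using z_expansion_exists[OF b(1)] unfolding has_z_expansion_def by blast
  have "2 * ?d \<le> n * ?d" using n by (rule mult_le_mono1)
  then have le: "Suc ?d \<le> 2 * ?d" "Suc ?d \<le> n * ?d" using ndeg_z by linarith+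
  have mem: "\<beta> \<in> B" "\<gamma> \<in> B" "\<beta> + \<gamma> * z \<in> B" "z\<^sup>2 * H \<in> B" "\<beta> + \<gamma> * z + z\<^sup>2 * H \<in> B" "\<xi> j * G \<in> B"
    using e(3,4) coeff_ring_mem[OF e(1)] coeff_ring_mem[OF e(2)] j_facts
    by (auto intro!: add_mem mult_mem z_mem power_mem)
  have "G = 0"
  proof (rule ccontr)
    assume G: "G \<noteq> 0"
    have "(F ^^ (n * ?d)) b = 0" using iter_eq_0_mono[OF b(2) le(2)] .
    then have "(F ^^ (n * ?d)) (\<xi> j * G) = 0"
      unfolding e(5) using e(6) by (simp add: iter_add mem)
    then have "ndeg (\<xi> j * G) < n * ?d" using iter_eq_0_iff[of "\<xi> j * G"] mem G j_facts by simp
    then show False using G e(4) j_facts by (simp add: ndeg_mult ndeg_j)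
  qed
  have "H = 0"
  proof (rule ccontr)
    assume H: "H \<noteq> 0"
    have "(F ^^ (2 * ?d)) b = 0" using iter_eq_0_mono[OF b(2) le(1)] .
    moreover have "(F ^^ (2 * ?d)) (\<beta> + \<gamma> * z) = 0" using e(1,2) le(1) by (intro iter_linear) auto
    ultimately have "(F ^^ (2 * ?d)) (z\<^sup>2 * H) = 0"
      unfolding e(5) using \<open>G = 0\<close> by (simp add: iter_add mem)
    then have "ndeg (z\<^sup>2 * H) < 2 * ?d" using iter_eq_0_iff[of "z\<^sup>2 * H"] mem H z_nonzero by simp
    then show False using H e(3) by (simp add: ndeg_mult power_mem z_mem z_nonzero ndeg_power)
  qed
  then show ?thesis using that e \<open>G = 0\<close> by simp
qed

lemma kernel_eq:
  assumes b: "b \<in> B"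
  shows "F b = 0 \<longleftrightarrow> b \<in> coeff_ring j"
proof
  assume 0: "F b = 0"
  have "(F ^^ Suc (ndeg z)) b = 0" using 0 iter_eq_0_mono[of 1 b "Suc (ndeg z)"] by simp
  then obtain \<beta> \<gamma> where e: "\<beta> \<in> coeff_ring j" "\<gamma> \<in> coeff_ring j" "b = \<beta> + \<gamma> * z"
    using linear_of_low_degree b by blast
  have "F b = \<gamma> * F z"
    unfolding e(3) using e(1,2) by (simp add: F_add F_mult mult_mem coeff_ring_mem z_mem coeff_ring_killed)
  then have "\<gamma> = 0" using 0 F_z by simp
  then show "b \<in> coeff_ring j" using e by simp
qed (rule coeff_ring_killed)

end

section \<open>Maximality\<close>

text \<open>
  As \<open>D (D (E z)) = E (D (D z)) = 0\<close>, the element \<open>E z\<close> has the form \<open>\<beta> + \<gamma> z\<close>.  Applying \<open>D\<close> shows that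
  \<open>E (D z)\<close> is a multiple of \<open>D z\<close>, so it vanishes.  Since \<open>D z\<close> is divisible by all variables other
  than \<open>z\<close> and \<open>x\<^sub>j\<close>, these are killed by \<open>E\<close> as well.
\<close>

theorem (in homogeneous_lnd) commuting_kernel_eq:
  assumes E: "trinomial_lnd \<iota> k m n a \<xi> E"
    and commute: "\<And>b. b \<in> B \<Longrightarrow> D (E b) = E (D b)"
    and b: "b \<in> B"
  shows "E b = 0 \<longleftrightarrow> D b = 0"
proof -
  interpret E: trinomial_lnd \<iota> k m n a \<xi> E by (rule E)
  obtain j h where j: "j \<in> XY" "lookup \<mu> j = 1"
    and killed: "\<And>w. w \<in> XY - {j} \<Longrightarrow> D (\<xi> w) = 0"
    and h: "h \<in> B" "h \<noteq> 0" "D z = mval (\<mu> - single j 1) * h" and DDz: "D (D z) = 0"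
    by (rule shape_of_homogeneous_lnd) blast
  interpret D: trinomial_lnd_killing \<iota> k m n a \<xi> D j
    by unfold_locales (use j killed in auto)
  have kP: "keys (\<mu> - single j 1) \<subseteq> vars k m"
    using keys_minus_subset \<mu>_vars by (rule order_trans)
  let ?P = "mval (\<mu> - single j 1)"
  have P: "?P \<in> B" "?P \<noteq> 0" using mon_mem mon_nonzero kP by blast+
  have "ndeg z = 1" using ndeg_F[OF z_mem F_z] ndeg_eq_0[OF F_mem[OF z_mem] DDz] by simp
  moreover have "D (D (E z)) = 0"
    using commute DDz by (simp add: z_mem F_mem E.F_zero)
  ultimately obtain \<beta> \<gamma> where \<beta>\<gamma>: "\<beta> \<in> coeff_ring j" "\<gamma> \<in> coeff_ring j" "E z = \<beta> + \<gamma> * z"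
    using D.linear_of_low_degree[OF E.F_mem[OF z_mem]] by auto
  have "E (D z) = D (E z)" by (simp add: commute z_mem)
  also have "\<dots> = \<gamma> * D z"
    unfolding \<beta>\<gamma>(3) using \<beta>\<gamma>(1,2) by (simp add: F_add F_mult mult_mem D.coeff_ring_mem z_mem D.coeff_ring_killed)
  finally have "E (D z) = 0"
    using E.killed_if_dvd_image[of "D z" \<gamma>] \<beta>\<gamma>(2) by (auto simp: F_mem z_mem D.coeff_ring_mem)
  then have "E ?P = 0"
    using E.factor_killed[OF P(1) h(1)] P h by simp
  then have killed': "E (\<xi> w) = 0" if w: "w \<in> XY - {j}" for w
  proof (rule E.var_killed_if_mval_killed[OF kP])
    have "lookup \<mu> w \<noteq> 0" using w by (intro lookup_\<mu>_nonzero) simp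
    then show "w \<in> keys (\<mu> - single j 1)" using w by (auto simp: in_keys_iff lookup_minus lookup_single when_def)
  qed
  interpret E': trinomial_lnd_killing \<iota> k m n a \<xi> E j
    by unfold_locales (use j killed' in auto)
  show ?thesis using D.kernel_eq[OF b] E'.kernel_eq[OF b] by simp
qed

section \<open>A Laurent polynomial model of the coordinate ring\<close>

text \<open>
  A linear order on the variables orders the exponent vectors lexicographically, compatibly with
  addition, and this is why the Laurent polynomials form an integral domain.
\<close>

fun var_rank :: "var \<Rightarrow> nat" where
  "var_rank Vz = 0"
| "var_rank (Vx i) = 2 * i + 1"
| "var_rank (Vy s) = 2 * s + 2"

lemma var_rank_eq_iff: "var_rank v = var_rank w \<longleftrightarrow> v = w"
  by (cases v; cases w) (auto, presburger+)

instantiation var :: linorder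
begin

definition "v \<le> w \<longleftrightarrow> var_rank v \<le> var_rank w"
definition "v < w \<longleftrightarrow> var_rank v < var_rank w"

instance
  by standard (auto simp: less_eq_var_def less_var_def var_rank_eq_iff)

end

type_synonym 'a laurent = "(var \<Rightarrow>\<^sub>0 int) \<Rightarrow>\<^sub>0 'a"

lemma lookup_single_times:
  fixes p :: "('g::cancel_comm_monoid_add) \<Rightarrow>\<^sub>0 'a::comm_semiring_1"
  shows "lookup (single e c * p) (e + g) = c * lookup p g"
proof -
  have "single e c * p = (\<Sum>s\<in>keys p. single (e + s) (c * lookup p s))"
    by (subst sum_singles[of p, symmetric], subst sum_distrib_left) (simp add: mult_single)
  then show ?thesis
    by (simp add: lookup_sum lookup_single when_def sum.delta in_keys_iff)
qed

lemma scalar_hom_laurent: "scalar_hom (single 0 :: 'a::field \<Rightarrow> 'a laurent)"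
  by unfold_locales (auto simp: single_add mult_single)

definition laurent_exp :: "var set \<Rightarrow> (var \<Rightarrow>\<^sub>0 nat) \<Rightarrow> var \<Rightarrow>\<^sub>0 int" where
  "laurent_exp S t = (\<Sum>v\<in>S. single v (int (lookup t v)))"

lemma lookup_laurent_exp:
  "finite S \<Longrightarrow> lookup (laurent_exp S t) v = (if v \<in> S then int (lookup t v) else 0)"
  by (auto simp: laurent_exp_def lookup_sum lookup_single when_def sum.delta)

text \<open>
  The equation is solved for \<open>x\<^sub>1\<close>, and the other variables are free.
\<close>

definition nonpivot_vars :: "nat \<Rightarrow> nat \<Rightarrow> var set" where
  "nonpivot_vars k m = vars k m - {Vx 1}"

definition laurent_var :: "nat \<Rightarrow> nat \<Rightarrow> nat \<Rightarrow> (nat \<Rightarrow> nat) \<Rightarrow> var \<Rightarrow> 'a::field laurent" where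
  "laurent_var k m n a v =
     (if v = Vx 1 then (single (single Vz (int n)) 1 + 1) * single (- laurent_exp (nonpivot_vars k m) (tri_exp k m a)) 1
      else single (single v 1) 1)"

lemma single_power_int: "single e (1::'a::comm_semiring_1) ^ N = single (\<Sum>i<N. e) 1"
  by (induction N) (auto simp: mult_single add.commute)

lemma prod_laurent_var:
  assumes "Vx 1 \<notin> S" "finite S"
  shows "(\<Prod>v\<in>S. laurent_var k m n a v ^ lookup t v) = (single (laurent_exp S t) 1 :: 'a::field laurent)"
  using assms(2,1)
proof (induction S rule: finite_induct)
  case (insert v S)
  have "(\<Sum>i<N. single s (1::int)) = single s (int N)" for N and s :: var
    by (induction N) (auto simp: add.commute simp flip: single_add)
  then have "laurent_var k m n a v ^ lookup t v = (single (single v (int (lookup t v))) 1 :: 'a laurent)"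
    using insert.prems by (auto simp: laurent_var_def single_power_int)
  then show ?case using insert by (simp add: laurent_exp_def mult_single)
qed (simp add: laurent_exp_def)

text \<open>
  The exponent of the term of highest degree in \<open>z\<close> of the value of the monomial \<open>t\<close>, in which \<open>x\<^sub>1\<close>
  contributes \<open>z\<^sup>n x\<^sub>1 / M\<close>.
\<close>

definition leading_exp :: "nat \<Rightarrow> nat \<Rightarrow> nat \<Rightarrow> (nat \<Rightarrow> nat) \<Rightarrow> (var \<Rightarrow>\<^sub>0 nat) \<Rightarrow> var \<Rightarrow>\<^sub>0 int" where
  "leading_exp k m n a t = laurent_exp (nonpivot_vars k m) t
     - (\<Sum>i<lookup t (Vx 1). laurent_exp (nonpivot_vars k m) (tri_exp k m a))
     + single Vz (int (n * lookup t (Vx 1)))"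

lemma finite_nonpivot_vars: "finite (nonpivot_vars k m)"
  by (simp add: nonpivot_vars_def finite_vars)

lemma lookup_leading_exp:
  "lookup (leading_exp k m n a t) v =
     (if v \<in> nonpivot_vars k m then int (lookup t v) - int (lookup t (Vx 1)) * int (lookup (tri_exp k m a) v) else 0)
     + (if v = Vz then int (n * lookup t (Vx 1)) else 0)"
  by (auto simp: leading_exp_def lookup_add lookup_minus lookup_sum lookup_laurent_exp finite_nonpivot_vars
      lookup_single when_def)

lemma Vz_nonpivot: "Vz \<in> nonpivot_vars k m"
  by (simp add: nonpivot_vars_def vars_def)

lemma lookup_leading_exp_Vz:
  "lookup (leading_exp k m n a t) Vz = int (lookup t Vz + n * lookup t (Vx 1))"
  using lookup_leading_exp[of k m n a t Vz] by (simp add: Vz_nonpivot lookup_tri_exp)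

text \<open>
  The \<open>z\<close>-entry of the leading exponent is \<open>i + n l\<close>, where \<open>i < n\<close> is the exponent of \<open>z\<close> in the monomial
  and \<open>l\<close> that of \<open>x\<^sub>1\<close>.  Both can be read off, and then so can the other exponents.
\<close>

lemma leading_exp_inj:
  assumes s: "s \<in> reduced k m n" and t: "t \<in> reduced k m n"
    and eq: "leading_exp k m n a s = leading_exp k m n a t"
  shows "s = t"
proof -
  have zs: "lookup s Vz < n" "lookup t Vz < n" using s t by (auto simp: reduced_def)
  have "int (lookup s Vz + n * lookup s (Vx 1)) = int (lookup t Vz + n * lookup t (Vx 1))"
    using arg_cong[OF eq, of "\<lambda>e. lookup e Vz"] unfolding lookup_leading_exp_Vz .
  then have sum: "lookup s Vz + n * lookup s (Vx 1) = lookup t Vz + n * lookup t (Vx 1)" by linarith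
  have "(lookup s Vz + n * lookup s (Vx 1)) mod n = lookup s Vz"
    "(lookup t Vz + n * lookup t (Vx 1)) mod n = lookup t Vz" using zs by simp_all
  then have z: "lookup s Vz = lookup t Vz" using sum by metis
  then have x: "lookup s (Vx 1) = lookup t (Vx 1)" using sum zs by simp
  show ?thesis
  proof (rule poly_mapping_eqI)
    fix v
    consider "v = Vx 1" | "v \<in> nonpivot_vars k m" | "v \<notin> vars k m" by (auto simp: nonpivot_vars_def)
    then show "lookup s v = lookup t v"
    proof cases
      case 2
      have "lookup (leading_exp k m n a s) v = lookup (leading_exp k m n a t) v"
        using eq by simp
      then show ?thesis using 2 x z by (cases "v = Vz") (simp_all add: lookup_leading_exp)
    next
      case 3
      then have "v \<notin> keys s" "v \<notin> keys t" using s t by (auto simp: reduced_def)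
      then show ?thesis by (simp add: in_keys_iff)
    qed (use x in simp)
  qed
qed

lemma lookup_binomial_power:
  fixes g :: "var \<Rightarrow>\<^sub>0 int"
  assumes n: "n > 0" and g: "lookup g Vz \<ge> int (n * l)"
  shows "lookup ((single (single Vz (int n)) (1::'a::field_char_0) + 1) ^ l) g =
    (if g = single Vz (int (n * l)) then 1 else 0)"
proof -
  have sum: "(\<Sum>i<N. single Vz (int n)) = single Vz (int (n * N))" for N
    by (induction N) (auto simp: algebra_simps simp flip: single_add)
  have "(single (single Vz (int n)) (1::'a) + 1) ^ l =
      (\<Sum>i\<le>l. of_nat (l choose i) * single (single Vz (int n)) 1 ^ i)"
    by (simp add: binomial_ring)
  also have "\<dots> = (\<Sum>i\<le>l. single (single Vz (int (n * i))) (of_nat (l choose i)))"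
    by (intro sum.cong refl) (simp add: single_power_int sum mult_single flip: single_of_nat)
  finally have "lookup ((single (single Vz (int n)) (1::'a) + 1) ^ l) g =
      (\<Sum>i\<le>l. if i = l then (if g = single Vz (int (n * l)) then 1 else 0) else 0)"
  proof (simp only: lookup_sum, intro sum.cong refl)
    fix i assume i: "i \<in> {..l}"
    show "lookup (single (single Vz (int (n * i))) (of_nat (l choose i) :: 'a)) g =
        (if i = l then (if g = single Vz (int (n * l)) then 1 else 0) else 0)"
    proof (cases "i = l")
      case False
      then have "n * i < n * l" using i n by simp
      then have "int (n * i) < int (n * l)" by (simp only: of_nat_less_iff)
      then have "g \<noteq> single Vz (int (n * i))" using g by auto
      then show ?thesis using False by (auto simp: lookup_single when_def)
    qed (auto simp: lookup_single when_def)
  qed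
  then show ?thesis by simp
qed

lemma mval_laurent:
  assumes t: "keys t \<subseteq> vars k m" and k: "k \<ge> 1"
  shows "mon_eval (laurent_var k m n a :: var \<Rightarrow> 'a::field laurent) t =
    single (leading_exp k m n a t - single Vz (int (n * lookup t (Vx 1)))) 1 *
      (single (single Vz (int n)) 1 + 1) ^ lookup t (Vx 1)"
proof -
  let ?\<xi> = "laurent_var k m n a :: var \<Rightarrow> 'a laurent" and ?l = "lookup t (Vx 1)"
  have x: "Vx 1 \<in> vars k m" using k by (simp add: vars_def)
  have "mon_eval ?\<xi> t = (\<Prod>v\<in>vars k m. ?\<xi> v ^ lookup t v)"
    using t by (intro mon_eval_superset finite_vars)
  also have "\<dots> = ?\<xi> (Vx 1) ^ ?l * (\<Prod>v\<in>nonpivot_vars k m. ?\<xi> v ^ lookup t v)"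
    unfolding nonpivot_vars_def using finite_vars x by (rule prod.remove)
  also have "(\<Prod>v\<in>nonpivot_vars k m. ?\<xi> v ^ lookup t v) = single (laurent_exp (nonpivot_vars k m) t) 1"
    by (intro prod_laurent_var finite_nonpivot_vars) (simp add: nonpivot_vars_def)
  also have "?\<xi> (Vx 1) ^ ?l = (single (single Vz (int n)) 1 + 1) ^ ?l *
      single (\<Sum>i<?l. - laurent_exp (nonpivot_vars k m) (tri_exp k m a)) 1"
    by (simp add: laurent_var_def power_mult_distrib single_power_int)
  finally show ?thesis
    by (simp add: leading_exp_def sum_negf mult_single mult.assoc mult.commute[of "_ ^ ?l"])
qed

text \<open>
  Linear independence: among the reduced monomials of a polynomial, one whose leading exponent
  has the largest \<open>z\<close>-entry is the only one whose value contains that exponent.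
\<close>

lemma trinomial_model_laurent:
  assumes k: "k \<ge> 1" and n: "n \<ge> 2" and a: "\<And>s. s \<in> {1..m} \<Longrightarrow> a s > 1"
  shows "trinomial_model (single 0 :: 'a::field_char_0 \<Rightarrow> 'a laurent) k m n a (laurent_var k m n a)"
proof -
  let ?\<iota> = "single 0 :: 'a \<Rightarrow> 'a laurent" and ?\<xi> = "laurent_var k m n a :: var \<Rightarrow> 'a laurent"
  let ?Q = "single (single Vz (int n)) 1 + 1 :: 'a laurent"
  interpret scalar_hom ?\<iota> by (rule scalar_hom_laurent)
  show ?thesis
  proof
    let ?\<mu> = "tri_exp k m a"
    have x: "lookup ?\<mu> (Vx 1) = 1" using k by (simp add: lookup_tri_exp)
    have lead: "leading_exp k m n a ?\<mu> = single Vz (int n)"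
      unfolding leading_exp_def x by simp
    have "mon_eval ?\<xi> ?\<mu> = single (leading_exp k m n a ?\<mu> - single Vz (int (n * lookup ?\<mu> (Vx 1)))) 1
        * ?Q ^ lookup ?\<mu> (Vx 1)"
      by (rule mval_laurent[OF keys_tri_exp_subset k])
    then have "mon_eval ?\<xi> ?\<mu> = ?Q" unfolding lead x by simp
    moreover have "(\<Prod>v\<in>{Vz}. ?\<xi> v ^ lookup (single Vz n) v) = single (laurent_exp {Vz} (single Vz n)) 1"
      by (rule prod_laurent_var) auto
    ultimately show "mon_eval ?\<xi> ?\<mu> = ?\<xi> Vz ^ n + 1" by (simp add: laurent_exp_def)
  next
    fix p :: "'a mpoly"
    assume p: "keys p \<subseteq> reduced k m n" and 0: "mpoly_eval ?\<iota> ?\<xi> p = 0"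
    show "p = 0"
    proof (rule ccontr)
      assume "p \<noteq> 0"
      let ?N = "\<lambda>t. lookup t Vz + n * lookup t (Vx 1)"
      have "keys p \<noteq> {}" using \<open>p \<noteq> 0\<close> by simp
      then have "Max (?N ` keys p) \<in> ?N ` keys p" by (intro Max_in) auto
      then obtain t0 where t0: "t0 \<in> keys p" and max: "Max (?N ` keys p) = ?N t0" by blast
      have t0_max: "?N t \<le> ?N t0" if "t \<in> keys p" for t
        unfolding max[symmetric] using that by (intro Max_ge) auto
      let ?g = "leading_exp k m n a t0"
      have coeff: "lookup (mon_eval ?\<xi> t) ?g = (if t = t0 then 1 else 0)" if t: "t \<in> keys p" for t
      proof -
        let ?L = "single Vz (int (n * lookup t (Vx 1)))" and ?E = "leading_exp k m n a t"
        have kt: "keys t \<subseteq> vars k m" using p t by (auto simp: reduced_def)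
        have g: "?g = (?E - ?L) + (?g - ?E + ?L)" by simp
        have "lookup (mon_eval ?\<xi> t) ?g = lookup (?Q ^ lookup t (Vx 1)) (?g - ?E + ?L)"
          by (subst g, subst mval_laurent[OF kt k], subst lookup_single_times) simp
        also have "\<dots> = (if ?g - ?E + ?L = ?L then 1 else 0)"
        proof (rule lookup_binomial_power)
          have "int (?N t) \<le> int (?N t0)" using t0_max[OF t] by (simp only: of_nat_le_iff)
          then show "int (n * lookup t (Vx 1)) \<le> lookup (?g - ?E + ?L) Vz"
            by (simp only: lookup_add lookup_minus lookup_leading_exp_Vz lookup_single_eq)
        qed (use n in simp)
        also have "\<dots> = (if t = t0 then 1 else 0)"
          using leading_exp_inj[OF subsetD[OF p t] subsetD[OF p t0], of a] by auto
        finally show ?thesis .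
      qed
      have "lookup (mpoly_eval ?\<iota> ?\<xi> p) ?g = (\<Sum>t\<in>keys p. lookup p t * lookup (mon_eval ?\<xi> t) ?g)"
        unfolding mpoly_eval_def lookup_sum
        using lookup_single_times[of 0 _ _ ?g, where 'a='a] by (intro sum.cong refl) simp
      also have "\<dots> = (\<Sum>t\<in>keys p. if t = t0 then lookup p t else 0)"
        using coeff by (intro sum.cong refl) auto
      also have "\<dots> = lookup p t0" using t0 by (simp add: sum.delta)
      finally show False using 0 t0 by (simp add: in_keys_iff)
    qed
  qed (use k n a in auto)
qed

section \<open>Weights\<close>

lemma lookup_weight_relation:
  "lookup ((\<Sum>i=1..k. frag_of (Vx i)) + (\<Sum>s=1..m. frag_cmul (int (a s)) (frag_of (Vy s)))) v =
    int (lookup (tri_exp k m a) v)"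
  by (cases v) (auto simp: lookup_tri_exp lookup_add lookup_sum lookup_single when_def
      if_distrib[where f = "(*) _"] sum.delta cong: if_cong)

lemma weight_relations_combination:
  assumes "h \<in> weight_relations k m n a"
  shows "\<exists>l q. \<forall>v. lookup h v = l * int (lookup (tri_exp k m a) v) + q * (if v = Vz then int n else 0)"
proof -
  let ?G = "free_Abelian_group (vars k m)"
  let ?g1 = "(\<Sum>i=1..k. frag_of (Vx i)) + (\<Sum>s=1..m. frag_cmul (int (a s)) (frag_of (Vy s)))"
  let ?g2 = "frag_cmul (int n) (frag_of Vz)"
  have k1: "keys ?g1 \<subseteq> vars k m"
  proof
    fix v assume "v \<in> keys ?g1"
    then have "v \<in> keys (tri_exp k m a)" unfolding in_keys_iff lookup_weight_relation by simp
    then show "v \<in> vars k m" using keys_tri_exp_subset by blast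
  qed
  have k2: "keys ?g2 \<subseteq> vars k m" by (auto simp: vars_def)
  have l2: "lookup ?g2 v = (if v = Vz then int n else 0)" for v
    by (auto simp: lookup_single when_def)
  have inv: "inv\<^bsub>?G\<^esub> ?g1 = - ?g1" "inv\<^bsub>?G\<^esub> ?g2 = - ?g2"
    by (rule inv_free_Abelian_group[OF k1], rule inv_free_Abelian_group[OF k2])
  from assms show ?thesis
    unfolding weight_relations_def
  proof (induction rule: generate.induct)
    case one
    show ?case by (rule exI[of _ 0], rule exI[of _ 0]) simp
  next
    case (incl h)
    then consider "h = ?g1" | "h = ?g2" by blast
    then show ?case
    proof cases
      case 1
      show ?thesis unfolding 1 lookup_weight_relation by (rule exI[of _ 1], rule exI[of _ 0]) simp
    next
      case 2
      show ?thesis unfolding 2 l2 by (rule exI[of _ 0], rule exI[of _ 1]) simp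
    qed
  next
    case (inv h)
    then consider "h = ?g1" | "h = ?g2" by blast
    then show ?case
    proof cases
      case 1
      show ?thesis unfolding 1 \<open>inv\<^bsub>?G\<^esub> ?g1 = - ?g1\<close> lookup_uminus lookup_weight_relation
        by (rule exI[of _ "- 1"], rule exI[of _ 0]) simp
    next
      case 2
      show ?thesis unfolding 2 \<open>inv\<^bsub>?G\<^esub> ?g2 = - ?g2\<close> lookup_uminus l2
        by (rule exI[of _ 0], rule exI[of _ "- 1"]) simp
    qed
  next
    case (eng h1 h2)
    obtain l q l' q' where
      "\<forall>v. lookup h1 v = l * int (lookup (tri_exp k m a) v) + q * (if v = Vz then int n else 0)"
      "\<forall>v. lookup h2 v = l' * int (lookup (tri_exp k m a) v) + q' * (if v = Vz then int n else 0)"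
      using eng.IH by blast
    then show ?case
      by (intro exI[of _ "l + l'"] exI[of _ "q + q'"]) (simp add: lookup_add algebra_simps)
  qed
qed

lemma lookup_map_int: "lookup (Poly_Mapping.map int t) v = int (lookup t v)"
  by (simp add: Poly_Mapping.map.rep_eq when_def)

lemma subgroup_weight_relations:
  "weight_relations k m n a \<subseteq> carrier (free_Abelian_group (vars k m))"
  "0 \<in> weight_relations k m n a"
proof -
  show "weight_relations k m n a \<subseteq> carrier (free_Abelian_group (vars k m))"
  proof
    fix h assume "h \<in> weight_relations k m n a"
    then obtain l q where lq: "\<forall>v. lookup h v = l * int (lookup (tri_exp k m a) v) + q * (if v = Vz then int n else 0)"
      using weight_relations_combination by blast
    have "keys h \<subseteq> vars k m"
    proof
      fix v assume "v \<in> keys h"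
      then have "v = Vz \<or> v \<in> keys (tri_exp k m a)" using lq by (auto simp: in_keys_iff)
      then show "v \<in> vars k m" using keys_tri_exp_subset[of k m a] by (auto simp: vars_def)
    qed
    then show "h \<in> carrier (free_Abelian_group (vars k m))" by simp
  qed
  show "0 \<in> weight_relations k m n a"
    using generate.one[of "free_Abelian_group (vars k m)"] by (simp add: weight_relations_def)
qed

lemma weight_eq_imp_same_weight:
  assumes "weight k m n a s = weight k m n a t"
  shows "same_weight k m n a s t"
proof -
  have "Poly_Mapping.map int s \<in> weight k m n a s"
    unfolding weight_def r_coset_def using subgroup_weight_relations(2)[of k m n a] by force
  then obtain h where h: "h \<in> weight_relations k m n a" "Poly_Mapping.map int s = h + Poly_Mapping.map int t"
    unfolding assms unfolding weight_def r_coset_def by auto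
  obtain l q where "\<forall>v. lookup h v = l * int (lookup (tri_exp k m a) v) + q * (if v = Vz then int n else 0)"
    using weight_relations_combination[OF h(1)] by blast
  moreover have "int (lookup s v) = lookup h v + int (lookup t v)" for v
    using arg_cong[OF h(2), of "\<lambda>p. lookup p v"] by (simp add: lookup_add lookup_map_int)
  ultimately show ?thesis
    unfolding same_weight_def by (intro exI[of _ l] exI[of _ q]) simp
qed

lemma weight_mem:
  assumes "keys t \<subseteq> vars k m"
  shows "weight k m n a t \<in> carrier (weight_group k m n a)"
proof -
  have "keys (Poly_Mapping.map int t) \<subseteq> vars k m"
    using assms by (auto simp: in_keys_iff lookup_map_int)
  then show ?thesis
    unfolding weight_group_def weight_def FactGroup_def RCOSETS_def by auto
qed

section \<open>The coordinate ring\<close>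

lemma ideal_trinomial: "ideal (trinomial_ideal k m n a) (mpoly_ring k m :: 'a::field mpoly ring)"
  unfolding trinomial_ideal_def
  by (rule cring.cgenideal_ideal[OF cring_mpoly_ring trinomial_mem])

lemma mpoly_ring_minus:
  assumes "p \<in> mpolys k m" "q \<in> mpolys k m"
  shows "p \<ominus>\<^bsub>mpoly_ring k m\<^esub> q = p - (q :: 'a::field mpoly)"
proof -
  interpret cring "mpoly_ring k m :: 'a mpoly ring" by (rule cring_mpoly_ring)
  have "\<ominus>\<^bsub>mpoly_ring k m\<^esub> q = - q"
    using assms by (intro minus_equality) (auto simp: mpoly_ring_ops mpolys_uminus)
  then show ?thesis by (simp add: a_minus_def mpoly_ring_ops)
qed

lemma carrier_coord_ring: "carrier (coord_ring k m n a) = residue_class k m n a ` mpolys k m"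
  by (auto simp: coord_ring_def FactRing_def A_RCOSETS_def' residue_class_def)

lemma residue_class_add:
  assumes "p \<in> mpolys k m" "q \<in> mpolys k m"
  shows "residue_class k m n a p \<oplus>\<^bsub>coord_ring k m n a\<^esub> residue_class k m n a q = residue_class k m n a (p + q)"
  using ring_hom_add[OF ideal.rcos_ring_hom[OF ideal_trinomial] assms]
  by (simp add: coord_ring_def residue_class_def mpoly_ring_ops)

lemma residue_class_mult:
  assumes "p \<in> mpolys k m" "q \<in> mpolys k m"
  shows "residue_class k m n a p \<otimes>\<^bsub>coord_ring k m n a\<^esub> residue_class k m n a q = residue_class k m n a (p * q)"
  using ring_hom_mult[OF ideal.rcos_ring_hom[OF ideal_trinomial] assms]
  by (simp add: coord_ring_def residue_class_def mpoly_ring_ops)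

lemma residue_class_zero: "\<zero>\<^bsub>coord_ring k m n a\<^esub> = residue_class k m n a (0 :: 'a::field mpoly)"
proof -
  interpret ideal "trinomial_ideal k m n a" "mpoly_ring k m :: 'a mpoly ring" by (rule ideal_trinomial)
  show ?thesis
    using a_coset_add_zero[OF a_subset] by (simp add: coord_ring_def FactRing_def residue_class_def mpoly_ring_ops)
qed

lemma residue_class_eq_iff:
  assumes "p \<in> mpolys k m" "q \<in> mpolys k m"
  shows "residue_class k m n a p = residue_class k m n a (q :: 'a::field mpoly) \<longleftrightarrow> p - q \<in> trinomial_ideal k m n a"
proof -
  interpret cring "mpoly_ring k m :: 'a mpoly ring" by (rule cring_mpoly_ring)
  show ?thesis
    using quotient_eq_iff_same_a_r_cos[OF ideal_trinomial assms] mpoly_ring_minus[OF assms]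
    by (simp add: residue_class_def)
qed

section \<open>Transport to the model\<close>

context trinomial_model
begin

abbreviation "CR \<equiv> coord_ring k m n a"
abbreviation "GF \<equiv> ground_field k m n a"
abbreviation "res \<equiv> residue_class k m n a"

lemma res_eq_iff:
  assumes "p \<in> mpolys k m" "q \<in> mpolys k m"
  shows "res p = res q \<longleftrightarrow> \<phi> p = \<phi> q"
  using residue_class_eq_iff[OF assms, of n a] \<phi>_eq_0_iff[OF mpolys_diff[OF assms]]
  by (simp add: mpoly_eval_diff)

text \<open>
  The value does not depend on the representative, by \<open>res_eq_iff\<close>.
\<close>

definition to_model :: "'a mpoly set \<Rightarrow> 'b" where
  "to_model C = \<phi> (SOME p. p \<in> mpolys k m \<and> res p = C)"

definition of_model :: "'b \<Rightarrow> 'a mpoly set" where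
  "of_model b = res (SOME p. p \<in> mpolys k m \<and> \<phi> p = b)"

lemma to_model_res:
  assumes "p \<in> mpolys k m" shows "to_model (res p) = \<phi> p"
proof -
  have "(SOME q. q \<in> mpolys k m \<and> res q = res p) \<in> mpolys k m \<and> res (SOME q. q \<in> mpolys k m \<and> res q = res p) = res p"
    by (rule someI[of _ p]) (simp add: assms)
  then show ?thesis unfolding to_model_def using res_eq_iff assms by blast
qed

lemma of_model_\<phi>:
  assumes "p \<in> mpolys k m" shows "of_model (\<phi> p) = res p"
proof -
  have "(SOME q. q \<in> mpolys k m \<and> \<phi> q = \<phi> p) \<in> mpolys k m \<and> \<phi> (SOME q. q \<in> mpolys k m \<and> \<phi> q = \<phi> p) = \<phi> p"
    by (rule someI[of _ p]) (simp add: assms)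
  then show ?thesis unfolding of_model_def using res_eq_iff assms by blast
qed

lemma of_model_mem: "b \<in> B \<Longrightarrow> of_model b \<in> carrier CR"
  by (auto elim!: B_E simp: of_model_\<phi> carrier_coord_ring)

lemma to_model_mem: "C \<in> carrier CR \<Longrightarrow> to_model C \<in> B"
  by (auto simp: to_model_res carrier_coord_ring B_I)

lemma to_of_model: "b \<in> B \<Longrightarrow> to_model (of_model b) = b"
  by (auto elim!: B_E simp: of_model_\<phi> to_model_res)

lemma of_to_model: "C \<in> carrier CR \<Longrightarrow> of_model (to_model C) = C"
  by (auto simp: of_model_\<phi> to_model_res carrier_coord_ring)

lemma of_model_add: "b \<in> B \<Longrightarrow> c \<in> B \<Longrightarrow> of_model (b + c) = of_model b \<oplus>\<^bsub>CR\<^esub> of_model c"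
  by (elim B_E) (simp add: of_model_\<phi> residue_class_add mpolys_add flip: mpoly_eval_add)

lemma of_model_mult: "b \<in> B \<Longrightarrow> c \<in> B \<Longrightarrow> of_model (b * c) = of_model b \<otimes>\<^bsub>CR\<^esub> of_model c"
  by (elim B_E) (simp add: of_model_\<phi> residue_class_mult mpolys_mult flip: mpoly_eval_mult)

lemma to_model_add:
  "C \<in> carrier CR \<Longrightarrow> C' \<in> carrier CR \<Longrightarrow> to_model (C \<oplus>\<^bsub>CR\<^esub> C') = to_model C + to_model C'"
  by (auto simp: carrier_coord_ring residue_class_add to_model_res mpolys_add mpoly_eval_add)

lemma to_model_mult:
  "C \<in> carrier CR \<Longrightarrow> C' \<in> carrier CR \<Longrightarrow> to_model (C \<otimes>\<^bsub>CR\<^esub> C') = to_model C * to_model C'"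
  by (auto simp: carrier_coord_ring residue_class_mult to_model_res mpolys_mult mpoly_eval_mult)

lemma to_model_eq_0_iff: "C \<in> carrier CR \<Longrightarrow> to_model C = 0 \<longleftrightarrow> C = \<zero>\<^bsub>CR\<^esub>"
  unfolding carrier_coord_ring
  by (elim imageE) (simp add: residue_class_zero to_model_res res_eq_iff mpolys_zero)

lemma CR_closed:
  "C \<in> carrier CR \<Longrightarrow> C' \<in> carrier CR \<Longrightarrow> C \<oplus>\<^bsub>CR\<^esub> C' \<in> carrier CR"
  "C \<in> carrier CR \<Longrightarrow> C' \<in> carrier CR \<Longrightarrow> C \<otimes>\<^bsub>CR\<^esub> C' \<in> carrier CR"
  by (auto simp: carrier_coord_ring residue_class_mult residue_class_add mpolys_mult mpolys_add)

definition transport :: "('a mpoly set \<Rightarrow> 'a mpoly set) \<Rightarrow> 'b \<Rightarrow> 'b" where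
  "transport D b = to_model (D (of_model b))"

lemma const_mem: "const_mpoly c \<in> mpolys k m"
  by (simp add: const_mpoly_def mpolys_single)

text \<open>
  The scalars are killed because \<open>D\<close> is linear over them and kills \<open>1\<close>.
\<close>

lemma transport_lnd:
  assumes lnd: "LND GF CR D" and nz: "nonzero_on CR D"
  shows "trinomial_lnd \<iota> k m n a \<xi> (transport D)"
proof -
  have D_mem: "D C \<in> carrier CR" if "C \<in> carrier CR" for C
    using lnd that by (auto simp: LND_def derivation_over_def)
  have D_add: "D (C \<oplus>\<^bsub>CR\<^esub> C') = D C \<oplus>\<^bsub>CR\<^esub> D C'" if "C \<in> carrier CR" "C' \<in> carrier CR" for C C'
    using lnd that by (simp add: LND_def derivation_over_def)
  have D_mult: "D (C \<otimes>\<^bsub>CR\<^esub> C') = (D C \<otimes>\<^bsub>CR\<^esub> C') \<oplus>\<^bsub>CR\<^esub> (C \<otimes>\<^bsub>CR\<^esub> D C')"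
    if "C \<in> carrier CR" "C' \<in> carrier CR" for C C'
    using lnd that by (simp add: LND_def derivation_over_def)
  have D_scale: "D (res (const_mpoly c) \<otimes>\<^bsub>CR\<^esub> C) = res (const_mpoly c) \<otimes>\<^bsub>CR\<^esub> D C" if "C \<in> carrier CR" for c C
    using lnd that unfolding LND_def derivation_over_def ground_field_def by blast
  have mult: "transport D (b * c) = transport D b * c + b * transport D c" if "b \<in> B" "c \<in> B" for b c
    using that by (simp add: transport_def of_model_mult of_model_mem D_mult D_mem to_model_add
        to_model_mult to_of_model CR_closed)
  have iter: "(transport D ^^ N) b = to_model ((D ^^ N) (of_model b)) \<and> (D ^^ N) (of_model b) \<in> carrier CR"
    if "b \<in> B" for b N
    by (induction N) (use that in \<open>auto simp: to_of_model of_model_mem transport_def of_to_model D_mem\<close>)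
  interpret lnd B "transport D"
  proof
    show "transport D b \<in> B" if "b \<in> B" for b
      using that by (simp add: transport_def to_model_mem of_model_mem D_mem)
    show "transport D (b + c) = transport D b + transport D c" if "b \<in> B" "c \<in> B" for b c
      using that by (simp add: transport_def of_model_add of_model_mem D_add D_mem to_model_add)
    show "\<exists>N. (transport D ^^ N) b = 0" if b: "b \<in> B" for b
    proof -
      obtain N where "(D ^^ N) (of_model b) = \<zero>\<^bsub>CR\<^esub>"
        using lnd of_model_mem[OF b] unfolding LND_def by blast
      then have "(transport D ^^ N) b = 0" using iter[OF b, of N] to_model_eq_0_iff by metis
      then show ?thesis ..
    qed
  qed (auto intro: B_one B_add B_mult B_uminus mult)
  show ?thesis
  proof
    fix c
    have "transport D (\<iota> c * 1) = \<iota> c * transport D 1"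
    proof -
      have "of_model (\<iota> c) = res (const_mpoly c)"
        using of_model_\<phi>[OF const_mem[of c]] by (simp add: mpoly_eval_const)
      moreover have "to_model (res (const_mpoly c)) = \<iota> c"
        using to_model_res[OF const_mem[of c]] by (simp add: mpoly_eval_const)
      moreover have "res (const_mpoly c) \<in> carrier CR"
        using const_mem by (auto simp: carrier_coord_ring)
      ultimately show ?thesis
        unfolding transport_def of_model_mult[OF scalar_mem B_one]
        by (simp add: D_scale of_model_mem B_one to_model_mult D_mem)
    qed
    then show "transport D (\<iota> c) = 0" using F_one by simp
  next
    obtain C where C: "C \<in> carrier CR" "D C \<noteq> \<zero>\<^bsub>CR\<^esub>" using nz by (auto simp: nonzero_on_def)
    then have "transport D (to_model C) \<noteq> 0"
      by (simp add: transport_def of_to_model to_model_eq_0_iff D_mem)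
    then show "\<exists>b\<in>B. transport D b \<noteq> 0" using to_model_mem[OF C(1)] by blast
  qed
qed

lemma transport_homogeneous:
  assumes "LND GF CR D" "nonzero_on CR D" and hom: "homogeneous_derivation k m n a D"
  shows "homogeneous_lnd \<iota> k m n a \<xi> (transport D)"
proof -
  interpret trinomial_lnd \<iota> k m n a \<xi> "transport D" by (rule transport_lnd[OF assms(1,2)])
  show ?thesis
  proof
    fix v assume v: "v \<in> vars k m"
    let ?t = "single v 1"
    have vm: "var_mpoly v \<in> mpolys k m" using v by (simp add: var_mpoly_def mpolys_single)
    have "homogeneous k m n a (res (var_mpoly v :: 'a mpoly))"
      unfolding homogeneous_def
    proof
      show "weight k m n a ?t \<in> carrier (weight_group k m n a)" using v by (intro weight_mem) simp
      show "res (var_mpoly v :: 'a mpoly) \<in> component k m n a (weight k m n a ?t)"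
        unfolding component_def using vm by (intro imageI) (auto simp: var_mpoly_def)
    qed
    then have "homogeneous k m n a (D (res (var_mpoly v)))"
      using hom by (simp add: homogeneous_derivation_def)
    then obtain w p where p: "p \<in> mpolys k m" "\<forall>t\<in>keys p. weight k m n a t = w" "D (res (var_mpoly v)) = res p"
      unfolding homogeneous_def component_def by blast
    have "of_model (\<xi> v) = res (var_mpoly v)"
      using of_model_\<phi>[OF vm] by (simp add: mpoly_eval_var)
    then have "transport D (\<xi> v) = \<phi> p" by (simp add: transport_def p to_model_res)
    moreover have "\<forall>s\<in>keys p. \<forall>t\<in>keys p. same_weight k m n a s t"
      using p(2) weight_eq_imp_same_weight by metis
    ultimately show "\<exists>p\<in>mpolys k m. transport D (\<xi> v) = \<phi> p \<and>
        (\<forall>s\<in>keys p. \<forall>t\<in>keys p. same_weight k m n a s t)"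
      using p(1) by blast
  qed
qed

end

theorem lemma9p1:
  fixes k m n :: nat
    and a :: "nat \<Rightarrow> nat"
    and D :: "'a::{alg_closed_field, field_char_0} mpoly set \<Rightarrow> 'a mpoly set"
  assumes "k \<ge> 1" and "n \<ge> 2"
    and "\<And>s. s \<in> {1..m} \<Longrightarrow> a s > 1"
    and "LND (ground_field k m n a) (coord_ring k m n a) D"
    and "nonzero_on (coord_ring k m n a) D"
    and "homogeneous_derivation k m n a D"
  shows "maximal_LND (ground_field k m n a) (coord_ring k m n a) D"
proof -
  interpret trinomial_model "single 0 :: 'a \<Rightarrow> 'a laurent" k m n a "laurent_var k m n a"
    by (rule trinomial_model_laurent[OF assms(1-3)])
  interpret D: homogeneous_lnd "single 0 :: 'a \<Rightarrow> 'a laurent" k m n a "laurent_var k m n a" "transport D"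
    by (rule transport_homogeneous[OF assms(4-6)])
  have D_mem: "D C \<in> carrier CR" if "C \<in> carrier CR" for C
    using assms(4) that by (auto simp: LND_def derivation_over_def)
  show ?thesis
    unfolding maximal_LND_def
  proof (intro conjI allI impI)
    fix E assume E: "LND GF CR E \<and> nonzero_on CR E \<and> commuting_on CR D E"
    have E_mem: "E C \<in> carrier CR" if "C \<in> carrier CR" for C
      using E that by (auto simp: LND_def derivation_over_def)
    have "transport E b = 0 \<longleftrightarrow> transport D b = 0" if "b \<in> B" for b
    proof (rule D.commuting_kernel_eq[OF _ _ that])
      show "trinomial_lnd (single 0 :: 'a \<Rightarrow> 'a laurent) k m n a (laurent_var k m n a) (transport E)"
        using E by (intro transport_lnd) auto
      show "transport D (transport E b) = transport E (transport D b)" if "b \<in> B" for b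
        using E of_model_mem[OF that]
        by (simp add: transport_def of_to_model D_mem E_mem commuting_on_def)
    qed
    then have "E C = \<zero>\<^bsub>CR\<^esub> \<longleftrightarrow> D C = \<zero>\<^bsub>CR\<^esub>" if "C \<in> carrier CR" for C
      using that to_model_mem[OF that]
      by (metis transport_def of_to_model to_model_eq_0_iff D_mem E_mem)
    then show "equivalent_LND CR E D"
      unfolding equivalent_LND_def a_kernel_def' by blast
  qed (use assms in auto)
qed

end
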